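(* Assume the explicit abc conjecture: whenever $a,b,c$ are pairwise coprime non-zero integers with $a+b=c$, one has $c<N(abc)^{7/4}$, where $N(x)=\prod_{p\mid x}p$. Let $2<s<t$ be integers and let $c>0$ be a fixed positive integer. Consider tuples of integers $(a_1,\dots,a_t,n_1,\dots,n_s)$ with $a_1\geq\cdots\geq a_t\geq 2$, $n_1\geq\cdots\geq n_s\geq 2$ and $a_l\neq n_j$ for all $l,j$, satisfying $$\prod_{l=1}^t a_l!=\prod_{j=1}^s n_j!.$$ Such a solution is trivial if there is a pair $(l,j)$ with $|a_l-n_j|=1$, and nontrivial otherwise. Let $i_2,\dots,i_s$ be distinct elements of $\{2,\dots,t\}$. Put $k_1=n_1-a_1$, $k_j=n_j-a_{i_j}$ for $j=2,\dots,s$, and $k=\max\{k_2,\dots,k_s\}$. Let $\mathcal{N}(c)_{\{i_2,\dots,i_s\}}$ be the set of nontrivial solutions with $n_1>a_1$, $n_j>a_{i_j}$ for $j=2,\dots,s$, and $k/k_1\leq c$. (For such solutions, with $m_1=a_1+1$, $m_j=a_{i_j}+1$ and $\Delta(m,k)=m(m+1)\cdots(m+k-1)$, the equation is equivalent to $\prod_{l\notin\{1,i_2,\dots,i_s\}}a_l!=\prod_{j=1}^s\Delta(m_j,k_j)$.) Then $\mathcal{N}(c)_{\{i_2,\dots,i_s\}}$ is finite. Consequently, the union $\mathcal{N}(c)$ of these sets over all choices of distinct $i_2,\dots,i_s\in\{2,\dots,t\}$ is finite, i.e. the equation $\prod_{l=1}^t a_l!=\prod_{j=1}^s n_j!$ has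 only finitely many solutions in $\mathcal{N}(c)$.
   Context: $N(x)$ denotes the product of the distinct primes dividing the non-zero integer $x$. The "explicit abc conjecture" is the hypothesis stated at the beginning of the claim. *)

theory Defs
  imports Complex_Main "HOL-Computational_Algebra.Primes"
begin

definition rad :: "int \<Rightarrow> int" where
  "rad x = (\<Prod>p\<in>prime_factors x. p)"

definition explicit_abc :: bool where
  "explicit_abc \<longleftrightarrow>
     (\<forall>a b c :: int. a \<noteq> 0 \<and> b \<noteq> 0 \<and> c \<noteq> 0 \<and>
        coprime a b \<and> coprime a c \<and> coprime b c \<and> a + b = c \<longrightarrow>
        real_of_int c < real_of_int (rad (a * b * c)) powr (7 / 4))"

text \<open>Tuples are lists: as = [a_1,...,a_t], ns = [n_1,...,n_s]; a_l = as ! (l-1).\<close>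
definition is_solution :: "nat \<Rightarrow> nat \<Rightarrow> nat list \<Rightarrow> nat list \<Rightarrow> bool" where
  "is_solution s t as ns \<longleftrightarrow>
     length as = t \<and> length ns = s \<and>
     (\<forall>l. 1 \<le> l \<and> l < t \<longrightarrow> as ! l \<le> as ! (l - 1)) \<and>
     (\<forall>j. 1 \<le> j \<and> j < s \<longrightarrow> ns ! j \<le> ns ! (j - 1)) \<and>
     (\<forall>x\<in>set as. 2 \<le> x) \<and> (\<forall>y\<in>set ns. 2 \<le> y) \<and>
     (\<forall>x\<in>set as. \<forall>y\<in>set ns. x \<noteq> y) \<and>
     prod_list (map (\<lambda>x. fact x :: nat) as) = prod_list (map (\<lambda>y. fact y :: nat) ns)"

definition is_nontrivial_solution :: "nat \<Rightarrow> nat \<Rightarrow> nat list \<Rightarrow> nat list \<Rightarrow> bool" where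
  "is_nontrivial_solution s t as ns \<longleftrightarrow>
     is_solution s t as ns \<and> (\<forall>x\<in>set as. \<forall>y\<in>set ns. \<bar>int x - int y\<bar> \<noteq> 1)"

definition valid_indices :: "nat \<Rightarrow> nat \<Rightarrow> (nat \<Rightarrow> nat) \<Rightarrow> bool" where
  "valid_indices s t i \<longleftrightarrow> (\<forall>j\<in>{2..s}. i j \<in> {2..t}) \<and> inj_on i {2..s}"

definition Nset :: "nat \<Rightarrow> nat \<Rightarrow> nat \<Rightarrow> (nat \<Rightarrow> nat) \<Rightarrow> (nat list \<times> nat list) set" where
  "Nset s t c i = {(as, ns). is_nontrivial_solution s t as ns \<and>
      as ! 0 < ns ! 0 \<and>
      (\<forall>j\<in>{2..s}. as ! (i j - 1) < ns ! (j - 1)) \<and>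
      real (Max ((\<lambda>j. ns ! (j - 1) - as ! (i j - 1)) ` {2..s})) / real (ns ! 0 - as ! 0)
        \<le> real c}"

end

theory Submission
  imports Defs "HOL-Number_Theory.Prime_Powers" "HOL-Complex_Analysis.Complex_Analysis"
    "HOL-Real_Asymp.Real_Asymp"
begin

text \<open>
  Write \<open>n = n\<^sub>1\<close>, \<open>k = n\<^sub>1 - a\<^sub>1 \<ge> 2\<close>, and let \<open>A\<close> be the largest \<open>a\<^sub>l\<close> that is not matched with
  some \<open>n\<^sub>j\<close>. Cancelling matched factorials shows that every prime factor of a number in the window
  \<open>{n - k<..n}\<close> is at most \<open>A \<le> n - k\<close>, whereas \<open>A! \<le> n\<^bsup>K k\<^esup>\<close> with \<open>K = 1 + (s - 1) c\<close>. For large \<open>n\<close> this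
  is impossible, for three different reasons:

  \<^item> If \<open>k \<le> n\<^bsup>1/8\<^esup>\<close>, the abc hypothesis for \<open>1 + (m - 1) = m\<close>, multiplied over the window, bounds the
    product of the radicals from below. It is at most \<open>e\<^bsup>\<psi>(A)\<^esup> k!\<close>, so \<open>A\<close> has order at least
    \<open>k ln n\<close>.
  \<^item> If \<open>n\<^bsup>1/8\<^esup> \<le> k \<le> \<delta> n\<close>, the prime powers exactly dividing \<open>n choose k\<close> are at most \<open>n\<close> and have
    base at most \<open>A\<close>, so \<open>(n/k)\<^sup>k \<le> (n choose k)\<close> makes \<open>A / k\<close> large.
  \<^item> If \<open>k > \<delta> n\<close>, the window contains a prime, which exceeds \<open>A\<close>.

  The last point needs primes in \<open>((1 - \<delta>) n, n]\<close> for arbitrary \<open>\<delta> > 0\<close>. This follows from the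
  non-vanishing of \<open>\<zeta>\<close> on the line of real part one as in the Wiener-Ikehara theorem: integrating
  \<open>- \<zeta>'/\<zeta> - \<zeta>\<close> against the Fourier transform of a Fejer kernel shows that the logarithmically weighted prime
  powers have the expected density in a window around \<open>ln n\<close>, up to an error controlled by the
  decay of the kernel and the Chebyshev bound.
\<close>

section \<open>Chebyshev bounds for the von Mangoldt function\<close>

lemma sum_divisors_eq_sum_interval:
  fixes f :: "nat \<Rightarrow> real"
  assumes "m > 0" "m \<le> N"
  shows "(\<Sum>d | d dvd m. f d) = (\<Sum>d\<in>{1..N}. if d dvd m then f d else 0)"
proof -
  have "{d. d dvd m} = {d\<in>{1..N}. d dvd m}"
    using assms dvd_imp_le[of _ m] dvd_pos_nat[of m] by force
  then show ?thesis by (simp only: sum.inter_filter[OF finite_atLeastAtMost])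
qed

lemma primepow_aprimedivisorD:
  assumes "primepow (d::nat)"
  shows "prime (aprimedivisor d)" "aprimedivisor d dvd d"
    "\<exists>i>0. d = aprimedivisor d ^ i"
proof -
  show p: "prime (aprimedivisor d)" "aprimedivisor d dvd d"
    using prime_aprimedivisor'[of d] aprimedivisor_dvd'[of d] primepow_gt_Suc_0[OF assms] by auto
  show "\<exists>i>0. d = aprimedivisor d ^ i"
    using primepow_decompose[OF assms] primepow_gt_Suc_0[OF assms]
    by (metis bot_nat_0.not_eq_extremum nat_neq_iff power_0 One_nat_def)
qed

text \<open>Legendre's formula in logarithmic form, from \<open>ln m\<close> being the sum of
  \<open>mangoldt\<close> over the divisors of \<open>m\<close>. Terms with \<open>d > n\<close>
  vanish, so several factorials can share one range up to \<open>N\<close>.\<close>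

lemma ln_fact_eq_sum_mangoldt:
  assumes "n \<le> N"
  shows "ln (fact n) = (\<Sum>d\<in>{1..N}. mangoldt d * real (n div d))"
  using assms
proof (induction n)
  case (Suc n)
  have "ln (fact (Suc n)) = ln (real (Suc n)) + ln (fact n :: real)"
    by (simp add: ln_mult del: of_nat_Suc)
  also have "ln (real (Suc n)) = (\<Sum>d | d dvd Suc n. mangoldt d)"
    using mangoldt_sum[of "Suc n", where ?'a=real] by simp
  also have "\<dots> = (\<Sum>d\<in>{1..N}. if d dvd Suc n then mangoldt d else 0)"
    using Suc.prems by (intro sum_divisors_eq_sum_interval) auto
  also have "ln (fact n :: real) = (\<Sum>d\<in>{1..N}. mangoldt d * real (n div d))"
    using Suc by simp
  also have "(\<Sum>d\<in>{1..N}. if d dvd Suc n then mangoldt d else 0) + \<dots> =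
      (\<Sum>d\<in>{1..N}. mangoldt d * real (Suc n div d))"
    unfolding sum.distrib[symmetric]
  proof (intro sum.cong refl)
    fix d assume "d \<in> {1..N}"
    show "(if d dvd Suc n then mangoldt d else 0) + mangoldt d * real (n div d) = mangoldt d * real (Suc n div d)"
      by (auto simp: div_Suc algebra_simps dvd_eq_mod_eq_0)
  qed
  finally show ?case .
qed (simp)

definition psi :: "nat \<Rightarrow> real" where
  "psi n = (\<Sum>d\<in>{1..n}. mangoldt d)"

lemma psi_nonneg: "psi n \<ge> 0"
  unfolding psi_def by (intro sum_nonneg) (auto simp: mangoldt_nonneg)

lemma ln_binomial_eq_sum_mangoldt:
  assumes "k \<le> n"
  shows "ln (real (n choose k)) =
    (\<Sum>d\<in>{1..n}. mangoldt d * (real (n div d) - real (k div d) - real ((n - k) div d)))"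
proof -
  have "ln (real (n choose k)) = ln (fact n) - ln (fact k) - ln (fact (n - k))"
    using assms by (simp add: binomial_fact ln_div ln_mult)
  then show ?thesis
    using assms by (simp add: ln_fact_eq_sum_mangoldt[of _ n] sum_subtractf[symmetric] algebra_simps)
qed

text \<open>In the expansion of \<open>ln (2 * n choose n)\<close> the coefficient of each
  \<open>d\<close> in \<open>{n<..2*n}\<close> is 1 and no other coefficient is negative; the
  binomial coefficient itself is at most \<open>4 ^ n\<close>.\<close>

lemma sum_mangoldt_dyadic_le:
  "(\<Sum>d\<in>{n<..2*n}. mangoldt d) \<le> real n * ln 4"
proof -
  have "(\<Sum>d\<in>{n<..2*n}. mangoldt d) =
        (\<Sum>d\<in>{n<..2*n}. mangoldt d * (real (2*n div d) - real (n div d) - real ((2*n - n) div d)))"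
  proof (intro sum.cong refl)
    fix d assume d: "d \<in> {n<..2*n}"
    then have "2 * n div d = 1"
      by (intro div_nat_eqI) auto
    with d show "mangoldt d = mangoldt d * (real (2*n div d) - real (n div d) - real ((2*n - n) div d))"
      by simp
  qed
  also have "\<dots> \<le> (\<Sum>d\<in>{1..2*n}. mangoldt d * (real (2*n div d) - real (n div d) - real ((2*n - n) div d)))"
  proof (intro sum_mono2)
    fix d assume "d \<in> {1..2*n} - {n<..2*n}"
    have "n div d + n div d \<le> (n + n) div d"
      using div_add1_eq[of n n d] by simp
    then have "real (n div d) + real (n div d) \<le> real ((2 * n) div d)"
      by (metis mult_2 of_nat_add of_nat_mono)
    then show "0 \<le> mangoldt d * (real (2*n div d) - real (n div d) - real ((2*n - n) div d))"
      by (intro mult_nonneg_nonneg mangoldt_nonneg) auto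
  qed auto
  also have "\<dots> = ln (real (2 * n choose n))"
    by (rule ln_binomial_eq_sum_mangoldt[symmetric]) simp
  also have "\<dots> \<le> ln (2 ^ (2 * n))"
  proof -
    have "real (2 * n choose n) \<le> real (2 ^ (2 * n))"
      by (intro of_nat_mono binomial_le_pow2)
    moreover have "0 < real (2 * n choose n)"
      by simp
    ultimately show ?thesis
      by (simp add: ln_mono)
  qed
  also have "\<dots> = real n * ln 4"
    by (simp add: power_mult ln_realpow)
  finally show ?thesis .
qed

lemma ln4_le_2: "ln (4::real) \<le> 2"
  using ln_add_one_self_le_self[of 1] ln_realpow[of 2 2] by simp

text \<open>Induction by halving: passing from \<open>m\<close> to \<open>2 * m\<close> costs at
  most \<open>2 * m\<close>, and an odd argument adds one more term of at most
  \<open>ln (1 + 2 * m)\<close>, hence at most \<open>2 * m\<close>.\<close>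

lemma psi_le: "psi n \<le> 4 * real n"
proof (induction n rule: less_induct)
  case (less n)
  show ?case
  proof (cases "n = 0")
    case True then show ?thesis by (simp add: psi_def)
  next
    case False
    define m where "m = n div 2"
    have m: "m < n" and n: "n = 2 * m \<or> n = Suc (2 * m)" using False by (auto simp: m_def)
    have "psi (2 * m) = psi m + (\<Sum>d\<in>{m<..2*m}. mangoldt d)"
      unfolding psi_def by (subst sum.union_disjoint[symmetric]) (auto intro!: sum.cong)
    then have 1: "psi (2 * m) \<le> 4 * real m + real m * 2"
      using less.IH[OF m] sum_mangoldt_dyadic_le[of m] mult_left_mono[OF ln4_le_2, of "real m"] by linarith
    have "psi (Suc (2*m)) \<le> psi (2*m) + 2 * real m"
      using mangoldt_le[of "Suc (2*m)"] ln_add_one_self_le_self[of "2 * real m"]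
      by (simp add: psi_def add.commute)
    with 1 n show ?thesis by auto
  qed
qed

section \<open>Prime powers with bounded base\<close>

definition psi_smooth :: "nat \<Rightarrow> nat \<Rightarrow> real" where
  "psi_smooth y n = (\<Sum>d | d \<in> {1..n} \<and> primepow d \<and> aprimedivisor d \<le> y. mangoldt d)"

text \<open>Powers with exponent at most \<open>r\<close> cost \<open>psi y\<close> for each
  exponent. A larger exponent forces the base down to \<open>z\<close>, while bases of at least 2
  force every exponent down to \<open>L\<close>.\<close>

lemma psi_smooth_le:
  assumes z: "\<And>p. p ^ Suc r \<le> n \<Longrightarrow> p \<le> z" and L: "n < 2 ^ Suc L"
  shows "psi_smooth y n \<le> real r * psi y + real L * psi z"
proof -
  define P where "P x = {p. prime p \<and> p \<le> (x::nat)}" for x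
  have finP [simp]: "finite (P x)" for x
    by (rule finite_subset[of _ "{..x}"]) (auto simp: P_def)
  define X where "X = {1..r} \<times> P y \<union> {1..L} \<times> P z"
  define f where "f = (\<lambda>(i,p). p ^ i :: nat)"
  have theta: "(\<Sum>p\<in>P x. ln (real p)) \<le> psi x" for x
  proof -
    have "(\<Sum>p\<in>P x. ln (real p)) = (\<Sum>p\<in>P x. mangoldt p)"
      by (intro sum.cong) (auto simp: P_def)
    also have "\<dots> \<le> psi x"
      unfolding psi_def by (intro sum_mono2) (auto simp: P_def mangoldt_nonneg intro: prime_ge_Suc_0_nat)
    finally show ?thesis .
  qed
  have sub: "{d. d \<in> {1..n} \<and> primepow d \<and> aprimedivisor d \<le> y} \<subseteq> f ` X"
  proof safe
    fix d assume d: "d \<in> {1..n}" "primepow d" "aprimedivisor d \<le> y"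
    define p where "p = aprimedivisor d"
    obtain i where i: "i > 0" "d = p ^ i" and p: "prime p"
      using primepow_aprimedivisorD[OF d(2)] unfolding p_def by blast
    show "d \<in> f ` X"
    proof (cases "i \<le> r")
      case True
      then have "(i, p) \<in> X" using i p d by (auto simp: X_def P_def p_def)
      then show ?thesis using i by (force simp: f_def)
    next
      case False
      have "p ^ Suc r \<le> p ^ i"
        using False p prime_ge_1_nat[of p] by (intro power_increasing) auto
      then have pz: "p \<le> z" using z i d by auto
      have "2 ^ i \<le> p ^ i" using p by (intro power_mono) (auto intro: prime_ge_2_nat)
      moreover have "p ^ i < 2 ^ Suc L" using i d L by auto
      ultimately have "(2::nat) ^ i < 2 ^ Suc L" by (rule le_less_trans)
      then have "i \<le> L" using power_less_imp_less_exp[of "2::nat" i "Suc L"] by simp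
      then have "(i, p) \<in> X" using i p pz by (auto simp: X_def P_def)
      then show ?thesis using i by (force simp: f_def)
    qed
  qed
  have *: "(\<Sum>x\<in>{1..m} \<times> P x'. mangoldt (f x)) = real m * (\<Sum>p\<in>P x'. ln (real p))" for m x'
  proof -
    have "(\<Sum>x\<in>{1..m} \<times> P x'. mangoldt (f x)) = (\<Sum>x\<in>{1..m} \<times> P x'. ln (real (snd x)))"
      by (intro sum.cong) (auto simp: f_def P_def)
    also have "\<dots> = real m * (\<Sum>p\<in>P x'. ln (real p))"
      by (subst sum.cartesian_product[where g="\<lambda>_ p. ln (real p)", unfolded case_prod_unfold, symmetric]) simp
    finally show ?thesis .
  qed
  have "psi_smooth y n \<le> (\<Sum>d\<in>f ` X. mangoldt d)"
    unfolding psi_smooth_def by (intro sum_mono2 sub) (auto simp: X_def mangoldt_nonneg)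
  also have "\<dots> \<le> (\<Sum>x\<in>X. mangoldt (f x))"
    by (rule sum_image_le[unfolded o_def]) (auto simp: X_def mangoldt_nonneg)
  also have "\<dots> \<le> (\<Sum>x\<in>{1..r} \<times> P y. mangoldt (f x)) + (\<Sum>x\<in>{1..L} \<times> P z. mangoldt (f x))"
    unfolding X_def by (subst sum.union_inter[symmetric]) (auto intro!: sum_nonneg mangoldt_nonneg)
  also have "\<dots> = real r * (\<Sum>p\<in>P y. ln (real p)) + real L * (\<Sum>p\<in>P z. ln (real p))"
    by (simp only: *)
  finally show ?thesis
    using mult_left_mono[OF theta[of y], of "real r"] mult_left_mono[OF theta[of z], of "real L"] by simp
qed

text \<open>Every prime power enters the binomial coefficient with weight at most 1, and a positive
  weight requires a multiple of it in the window, whose prime factors are at most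
  \<open>A\<close>.\<close>

lemma ln_binomial_le_psi_smooth:
  assumes "k \<le> n" and small: "\<And>m p. n - k < m \<Longrightarrow> m \<le> n \<Longrightarrow> prime p \<Longrightarrow> p dvd m \<Longrightarrow> p \<le> A"
  shows "ln (real (n choose k)) \<le> psi_smooth A n"
proof -
  have "ln (real (n choose k)) =
    (\<Sum>d\<in>{1..n}. mangoldt d * (real (n div d) - real (k div d) - real ((n - k) div d)))"
    by (rule ln_binomial_eq_sum_mangoldt[OF assms(1)])
  also have "\<dots> \<le> (\<Sum>d\<in>{1..n}. if primepow d \<and> aprimedivisor d \<le> A then mangoldt d else 0)"
  proof (intro sum_mono)
    fix d assume d: "d \<in> {1..n}"
    have n: "n = k + (n - k)" using assms by simp
    have "n div d = k div d + (n - k) div d + (k mod d + (n - k) mod d) div d"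
      by (subst n, rule div_add1_eq)
    moreover have "(k mod d + (n - k) mod d) div d < 2"
    proof (rule less_mult_imp_div_less)
      have "k mod d < d" "(n - k) mod d < d" using d by auto
      then show "k mod d + (n - k) mod d < 2 * d" by linarith
    qed
    ultimately have le1: "real (n div d) - real (k div d) - real ((n - k) div d) \<le> 1" by auto
    show "mangoldt d * (real (n div d) - real (k div d) - real ((n - k) div d))
        \<le> (if primepow d \<and> aprimedivisor d \<le> A then mangoldt d else 0)"
    proof (cases "primepow d \<and> \<not> aprimedivisor d \<le> A")
      case False
      then show ?thesis
        using mult_left_mono[OF le1 mangoldt_nonneg[of d]] by (auto simp: mangoldt_def)
    next
      case True
      have "real (n div d) - real ((n - k) div d) \<le> 0"
      proof (rule ccontr)
        assume "\<not> ?thesis"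
        then have "(n - k) div d < n div d" by simp
        \<comment> \<open>The largest multiple of \<open>d\<close> up to \<open>n\<close>; if the
          two quotients differ, it lies beyond \<open>n - k\<close>.\<close>
        define m where "m = d * (n div d)"
        have "m \<le> n" by (simp add: m_def)
        moreover have "n - k < d * (Suc ((n - k) div d))"
          using d using dividend_less_times_div[of d "n - k"] by simp
        then have "n - k < m"
          using \<open>(n - k) div d < n div d\<close> unfolding m_def by (meson Suc_leI less_le_trans mult_le_mono2)
        moreover have "aprimedivisor d dvd m" "prime (aprimedivisor d)"
          using True primepow_aprimedivisorD[of d] by (auto simp: m_def)
        ultimately show False using small True by blast
      qed
      then have "real (n div d) - real (k div d) - real ((n - k) div d) \<le> 0"
        by linarith
      then show ?thesis using True by (simp add: mult_nonneg_nonpos mangoldt_nonneg)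
    qed
  qed
  also have "\<dots> = psi_smooth A n"
    unfolding psi_smooth_def by (subst sum.inter_filter[symmetric]) (auto intro!: sum.cong)
  finally show ?thesis .
qed

section \<open>The zeta function near the line of real part one\<close>

lemma norm_nat_powr: "norm (of_nat n powr s :: complex) = real n powr Re s"
  by (cases "n = 0") (auto simp: norm_powr_real_powr)

lemma has_field_derivative_nat_powr:
  "((\<lambda>s. of_nat n powr s :: complex) has_field_derivative of_real (ln (real n)) * of_nat n powr s) (at s)"
proof (cases "n = 0")
  case False
  have "((\<lambda>s. of_nat n powr s :: complex) has_field_derivative Ln (of_nat n) * of_nat n powr s) (at s)"
    using False by (intro has_field_derivative_powr_right) auto
  moreover have "Ln (of_nat n) = of_real (ln (real n))"
    using False by (simp add: Ln_of_nat)
  ultimately show ?thesis by simp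
qed auto

lemma summable_ln_nat_powr:
  fixes a :: real assumes "a > 1"
  shows "summable (\<lambda>n. ln (real n) * real n powr (-a))"
proof (rule summable_comparison_test[OF exI, of 1])
  \<comment> \<open>Half of the excess \<open>a - 1\<close> pays for the logarithm; the remaining
    exponent \<open>e - a = - (a + 1) / 2\<close> is still below -1.\<close>
  define e where "e = (a - 1) / 2"
  have e: "e > 0" using assms by (simp add: e_def)
  show "summable (\<lambda>n. real n powr (e - a) / e)"
    using assms by (intro summable_divide) (auto simp: summable_real_powr_iff e_def field_simps)
  show "\<forall>n\<ge>1. norm (ln (real n) * real n powr (-a)) \<le> real n powr (e - a) / e"
  proof safe
    fix n :: nat assume n: "1 \<le> n"
    have "ln (real n) * real n powr (-a) \<le> real n powr e / e * real n powr (-a)"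
      using n e by (intro mult_right_mono ln_powr_bound) auto
    also have "\<dots> = real n powr (e - a) / e"
      by (simp add: powr_add[symmetric])
    finally show "norm (ln (real n) * real n powr (-a)) \<le> real n powr (e - a) / e"
      using n by (simp add: abs_mult)
  qed
qed

lemma summable_norm_nat_powr:
  assumes "Re s > 1"
  shows "summable (\<lambda>n. norm (of_nat n powr (-s) :: complex))"
  using assms by (simp add: norm_nat_powr summable_real_powr_iff)

lemma summable_mangoldt_powr:
  assumes "a > 1"
  shows "summable (\<lambda>n. mangoldt n * real n powr (-a))"
proof (rule summable_comparison_test[OF exI, of 1])
  show "\<forall>n\<ge>1. norm (mangoldt n * real n powr (-a)) \<le> ln (real n) * real n powr (-a)"
    by (auto simp: abs_mult mangoldt_le intro!: mult_right_mono)
qed (use assms summable_ln_nat_powr in auto)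

lemma summable_norm_mangoldt_powr:
  assumes "Re s > 1"
  shows "summable (\<lambda>n. norm (mangoldt n * of_nat n powr (-s) :: complex))"
  using summable_mangoldt_powr[of "Re s"] assms by (simp add: norm_mult norm_nat_powr)

section \<open>Dirichlet series of zeta and of its logarithmic derivative\<close>

text \<open>The term with index 0 vanishes because \<open>0 powr s = 0\<close>, so this is the usual
  series on its half plane of convergence.\<close>

definition zeta :: "complex \<Rightarrow> complex" where
  "zeta s = (\<Sum>n. of_nat n powr (-s))"

text \<open>On the half plane of convergence this is the negative logarithmic derivative of
  zeta.\<close>

definition mangoldt_series :: "complex \<Rightarrow> complex" where
  "mangoldt_series s = (\<Sum>n. mangoldt n * of_nat n powr (-s))"

lemma zeta_sums: "Re s > 1 \<Longrightarrow> (\<lambda>n. of_nat n powr (-s)) sums zeta s"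
  unfolding zeta_def by (intro summable_sums summable_norm_cancel[OF summable_norm_nat_powr])

lemma mangoldt_series_sums: "Re s > 1 \<Longrightarrow> (\<lambda>n. mangoldt n * of_nat n powr (-s)) sums mangoldt_series s"
  unfolding mangoldt_series_def
  by (intro summable_sums summable_norm_cancel[OF summable_norm_mangoldt_powr])

text \<open>The family \<open>f d * g m\<close> over pairs of positive indices is absolutely
  summable. Summing by rows gives \<open>F * G\<close>; the bijection from \<open>(d, m)\<close> to
  \<open>(d * m, d)\<close> regroups it by the product of the indices.\<close>

lemma dirichlet_product_sums:
  fixes f g :: "nat \<Rightarrow> complex"
  assumes f: "summable (\<lambda>n. norm (f n))" "f sums F" "f 0 = 0"
    and g: "summable (\<lambda>n. norm (g n))" "g sums G" "g 0 = 0"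
  shows "(\<lambda>n. if n = 0 then 0 else \<Sum>d | d dvd n. f d * g (n div d)) sums (F * G)"
proof -
  have pos: "(h has_sum S) {0<..}" if "summable (\<lambda>n. norm (h n))" "h sums S" "h 0 = 0"
    for h :: "nat \<Rightarrow> complex" and S
  proof -
    have "(h has_sum S) {0<..} = (h has_sum S) UNIV"
      using that(3) by (intro has_sum_cong_neutral) auto
    then show ?thesis using norm_summable_imp_has_sum[OF that(1,2)] by simp
  qed
  have hf: "(f has_sum F) {0<..}" and hg: "(g has_sum G) {0<..}"
    using pos f g by blast+
  have nf: "(\<lambda>n. norm (f n)) summable_on {0<..}" and ng: "(\<lambda>n. norm (g n)) summable_on {0<..}"
    using hf hg by (simp_all add: summable_on_iff_abs_summable_on_complex[symmetric] has_sum_imp_summable)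
  define h where "h = (\<lambda>(d,m). f d * g m)"
  have "(\<lambda>x. norm (h x)) summable_on ({0<..} \<times> {0<..})"
    unfolding Infinite_Sum.abs_summable_on_Sigma_iff
  proof (intro conjI ballI)
    fix d show "(\<lambda>m. norm (h (d, m))) summable_on {0<..}"
      unfolding h_def using ng by (simp add: norm_mult summable_on_cmult_right)
  next
    have "(\<Sum>\<^sub>\<infinity>m\<in>{0<..}. norm (h (d, m))) = norm (f d) * (\<Sum>\<^sub>\<infinity>m\<in>{0<..}. norm (g m))" for d
      unfolding h_def using ng by (simp add: norm_mult infsum_cmult_right)
    then show "(\<lambda>d. norm (\<Sum>\<^sub>\<infinity>m\<in>{0<..}. norm (h (d, m)))) summable_on {0<..}"
      using nf by (simp add: abs_mult summable_on_cmult_left)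
  qed
  then have "h summable_on ({0<..} \<times> {0<..})"
    by (rule Infinite_Sum.abs_summable_summable)
  then obtain S where S: "(h has_sum S) ({0<..} \<times> {0<..})"
    by (auto simp: summable_on_def)
  have "((\<lambda>d. f d * G) has_sum S) {0<..}"
    using S by (rule has_sum_SigmaD) (auto simp: h_def intro: has_sum_cmult_right hg)
  moreover have "((\<lambda>d. f d * G) has_sum (F * G)) {0<..}"
    by (intro has_sum_cmult_left hf)
  ultimately have "S = F * G" by (rule has_sum_unique)
  have "(h has_sum S) ({0<..} \<times> {0<..}) =
      ((\<lambda>(n,d). f d * g (n div d)) has_sum S) (Sigma {0<..} (\<lambda>n. {d. d dvd n}))"
  proof (rule has_sum_reindex_bij_witness[of _ "\<lambda>(n,d). (d, n div d)" "\<lambda>(d,m). (d * m, d)"])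
    fix b :: "nat \<times> nat" assume "b \<in> Sigma {0<..} (\<lambda>n. {d. d dvd n})"
    then obtain d m where "b = (d * m, d)" "d * m > 0" by (cases b) (auto elim!: dvdE)
    then show "(case case b of (n, d) \<Rightarrow> (d, n div d) of (d, m) \<Rightarrow> (d * m, d)) = b"
      "(case b of (n, d) \<Rightarrow> (d, n div d)) \<in> {0<..} \<times> {0<..}"
      by auto
  qed (auto simp: h_def)
  with S have "((\<lambda>(n,d). f d * g (n div d)) has_sum S) (Sigma {0<..} (\<lambda>n. {d. d dvd n}))"
    by simp
  then have "((\<lambda>n. \<Sum>d | d dvd n. f d * g (n div d)) has_sum S) {0<..}"
    by (rule has_sum_SigmaD) (auto intro!: has_sum_finite)
  then have "((\<lambda>n. if n = 0 then 0 else \<Sum>d | d dvd n. f d * g (n div d)) has_sum S) UNIV"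
    by (rule has_sum_cong_neutral[THEN iffD1, rotated -1]) auto
  then show ?thesis
    unfolding \<open>S = F * G\<close> by (rule has_sum_imp_sums)
qed

text \<open>The Dirichlet convolution of \<open>mangoldt\<close> with the constant 1 is the
  logarithm.\<close>

lemma mangoldt_series_times_zeta_sums:
  assumes "Re s > 1"
  shows "(\<lambda>n. of_real (ln (real n)) * of_nat n powr (-s)) sums (mangoldt_series s * zeta s)"
proof -
  have "(\<lambda>n. if n = 0 then 0 else \<Sum>d | d dvd n. (mangoldt d * of_nat d powr (-s)) * of_nat (n div d) powr (-s))
     sums (mangoldt_series s * zeta s)"
    using assms by (intro dirichlet_product_sums summable_norm_mangoldt_powr summable_norm_nat_powr
        mangoldt_series_sums zeta_sums) auto
  also have "(\<lambda>n. if n = 0 then 0 else \<Sum>d | d dvd n. (mangoldt d * of_nat d powr (-s)) * of_nat (n div d) powr (-s))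
      = (\<lambda>n. of_real (ln (real n)) * of_nat n powr (-s))"
  proof
    fix n :: nat
    show "(if n = 0 then 0 else \<Sum>d | d dvd n. (mangoldt d * of_nat d powr (-s)) * of_nat (n div d) powr (-s))
      = of_real (ln (real n)) * of_nat n powr (-s)"
    proof (cases "n = 0")
      case False
      have "(\<Sum>d | d dvd n. (mangoldt d * of_nat d powr (-s)) * of_nat (n div d) powr (-s)) =
          (\<Sum>d | d dvd n. mangoldt d * of_nat n powr (-s))"
      proof (intro sum.cong refl)
        fix d assume "d \<in> {d. d dvd n}"
        then have "n = d * (n div d)" by simp
        then have "of_nat n = (of_nat d * of_nat (n div d) :: complex)"
          by (metis of_nat_mult)
        moreover have "(of_nat d * of_nat (n div d) :: complex) powr (-s) = of_nat d powr (-s) * of_nat (n div d) powr (-s)"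
          by (intro powr_times_real_left) auto
        ultimately show "(mangoldt d * of_nat d powr (-s)) * of_nat (n div d) powr (-s) = mangoldt d * of_nat n powr (-s)"
          by simp
      qed
      also have "\<dots> = of_real (ln (real n)) * of_nat n powr (-s)"
        using False mangoldt_sum[of n, where ?'a=complex] by (simp add: sum_distrib_right[symmetric])
      finally show ?thesis using False by simp
    qed auto
  qed
  finally show ?thesis .
qed

text \<open>Termwise differentiation on a half plane \<open>Re z > a\<close> with
  \<open>1 < a < Re s\<close>, where the terms are dominated by \<open>n powr (-a)\<close>; the
  differentiated series is minus that of \<open>mangoldt_series_times_zeta_sums\<close>.\<close>

lemma has_field_derivative_zeta:
  assumes "Re s > 1"
  shows "(zeta has_field_derivative - (mangoldt_series s * zeta s)) (at s)"
proof -
  define a where "a = (1 + Re s) / 2"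
  have a: "1 < a" "a < Re s" using assms by (auto simp: a_def)
  define S where "S = {z. Re z > a}"
  have S: "open S" unfolding S_def by (rule open_halfspace_Re_gt)
  obtain g g' where g: "\<forall>x\<in>S. ((\<lambda>n. of_nat n powr (-x)) sums g x) \<and>
      ((\<lambda>n. - (of_real (ln (real n)) * of_nat n powr (-x))) sums g' x) \<and> (g has_field_derivative g' x) (at x)"
  proof (rule series_and_derivative_comparison[OF S])
    show "summable (\<lambda>n. real n powr (-a))"
      using a by (simp add: summable_real_powr_iff)
    show "\<forall>\<^sub>F n in sequentially. \<forall>x\<in>S. norm (of_nat n powr (-x) :: complex) \<le> real n powr (-a)"
      using eventually_ge_at_top[of 1]
      by eventually_elim (auto simp: norm_nat_powr S_def intro!: powr_mono)
    show "((\<lambda>x. of_nat n powr (-x)) has_field_derivative - (of_real (ln (real n)) * of_nat n powr (-x))) (at x)" for n and x :: complex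
      using DERIV_chain2[OF has_field_derivative_nat_powr[of n "-x"] DERIV_minus[OF DERIV_ident]] by simp
  qed
  have sS: "s \<in> S" using a by (simp add: S_def)
  have eq: "g x = zeta x" if "x \<in> S" for x
    using g that unfolding zeta_def by (simp add: sums_unique)
  have "g' s = - (mangoldt_series s * zeta s)"
    using g sS sums_minus[OF mangoldt_series_times_zeta_sums[OF assms]] sums_unique2 by blast
  then have "(g has_field_derivative - (mangoldt_series s * zeta s)) (at s)"
    using g sS by auto
  then show ?thesis
    by (rule has_field_derivative_transform_within_open[OF _ S sS]) (rule eq)
qed

section \<open>Continuation of \<open>(s - 1) * zeta s\<close> past the line of real part
  one\<close>

text \<open>Since the differences \<open>(n + 1)\<^bsup>1 - s\<^esup> - n\<^bsup>1 - s\<^esup>\<close> telescope to zero when \<open>Re s > 1\<close>, these summands add up to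
  \<open>(s - 1) \<zeta>(s)\<close>; unlike those of \<open>\<zeta>\<close>, they remain summable to the left of the line of real part one.
  The summand with \<open>n = 0\<close> equals \<open>1\<close>, because \<open>0 powr s = 0\<close>.\<close>

definition zeta_summand :: "nat \<Rightarrow> complex \<Rightarrow> complex" where
  "zeta_summand n s = (s - 1) * of_nat n powr (-s) - of_nat n powr (1 - s) + of_nat (Suc n) powr (1 - s)"

definition pole_free_zeta :: "complex \<Rightarrow> complex" where
  "pole_free_zeta s = (\<Sum>n. zeta_summand n s)"

text \<open>The summand is the remainder of the first-order Taylor expansion of
  \<open>x powr (1 - s)\<close> about \<open>n\<close>, taken at \<open>n + 1\<close>. It is
  governed by the second derivative, which is largest at \<open>n\<close> because
  \<open>- Re s - 1\<close> is not positive.\<close>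

lemma norm_zeta_summand_le:
  assumes n: "n > 0" and s: "Re s \<ge> -1"
  shows "norm (zeta_summand n s) \<le> norm (s - 1) * norm s * real n powr (- Re s - 1)"
proof -
  \<comment> \<open>The function \<open>x powr (1 - s)\<close> and its first two derivatives,
    indexed by order.\<close>
  define f where "f = (\<lambda>i::nat. \<lambda>x::complex. if i = 0 then x powr (1 - s) else if i = 1 then (1 - s) * x powr (-s)
      else (1 - s) * ((-s) * x powr (-s - 1)))"
  define S where "S = closed_segment (of_nat n :: complex) (of_nat (Suc n))"
  have S: "\<exists>u. x = of_real u \<and> real n \<le> u" if x: "x \<in> S" for x
  proof -
    obtain t where "0 \<le> t \<and> t \<le> 1 \<and> x = (1 - t) *\<^sub>R of_nat n + t *\<^sub>R of_nat (Suc n)"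
      using x[unfolded S_def in_segment(1)] by (rule exE)
    then have "x = of_real (real n + t)" "real n \<le> real n + t"
      by (simp_all add: complex_eq_iff algebra_simps)
    then show ?thesis by blast
  qed
  have *: "norm (f 0 (of_nat (Suc n)) - (\<Sum>i\<le>1. f i (of_nat n) * (of_nat (Suc n) - of_nat n) ^ i / fact i))
      \<le> (norm (s - 1) * norm s * real n powr (- Re s - 1)) * norm (of_nat (Suc n) - of_nat n :: complex) ^ Suc 1 / fact 1"
  proof (rule complex_Taylor[where S=S])
    show "convex S" "of_nat n \<in> S" "of_nat (Suc n) \<in> S" by (auto simp: S_def)
  next
    fix i x assume x: "x \<in> S" "i \<le> (1::nat)"
    from S[OF x(1)] n obtain u where u: "x = of_real u" "u > 0" by fastforce
    then have nz: "x \<notin> \<real>\<^sub>\<le>\<^sub>0" by (simp add: complex_nonpos_Reals_iff)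
    have 0: "((\<lambda>x. x powr (1 - s)) has_field_derivative (1 - s) * x powr (-s)) (at x)"
      using has_field_derivative_powr[OF nz, of "1 - s"] by simp
    have 1: "((\<lambda>x. (1 - s) * x powr (-s)) has_field_derivative (1 - s) * ((-s) * x powr (-s - 1))) (at x)"
      using has_field_derivative_powr[OF nz, of "-s"] by (rule DERIV_cmult)
    have "i = 0 \<or> i = 1" using x(2) by linarith
    then show "(f i has_field_derivative f (Suc i) x) (at x within S)"
    proof
      assume "i = 0"
      then show ?thesis using has_field_derivative_at_within[OF 0] by (simp add: f_def)
    next
      assume "i = 1"
      then show ?thesis using has_field_derivative_at_within[OF 1] by (simp add: f_def)
    qed
  next
    fix x assume x: "x \<in> S"
    from S[OF x] n obtain u where u: "x = of_real u" "u \<ge> real n" by blast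
    then have "norm (x powr (-s - 1)) = u powr (- Re s - 1)" using n by (simp add: norm_powr_real_powr)
    also have "\<dots> \<le> real n powr (- Re s - 1)"
      using u n s by (intro powr_mono2') auto
    finally have "norm (x powr (-s - 1)) \<le> real n powr (- Re s - 1)" .
    then have "norm (1 - s) * (norm s * norm (x powr (-s - 1))) \<le> norm (1 - s) * (norm s * real n powr (- Re s - 1))"
      by (intro mult_left_mono) auto
    then show "cmod (f (Suc 1) x) \<le> norm (s - 1) * norm s * real n powr (- Re s - 1)"
      by (simp add: f_def norm_mult norm_minus_commute mult.assoc)
  qed
  moreover have "f 0 (of_nat (Suc n)) - (\<Sum>i\<le>1. f i (of_nat n) * (of_nat (Suc n) - of_nat n) ^ i / fact i) = zeta_summand n s"
    by (simp add: f_def zeta_summand_def algebra_simps)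
  ultimately show ?thesis by simp
qed

lemma zeta_summand_holomorphic: "zeta_summand n holomorphic_on S"
proof -
  have 1: "(\<lambda>s. of_nat m powr (h s) :: complex) holomorphic_on S" if "h holomorphic_on S" for m :: nat and h
    by (cases "m = 0") (use that in \<open>auto intro!: holomorphic_intros\<close>)
  show ?thesis
    unfolding zeta_summand_def by (intro holomorphic_intros 1)
qed

text \<open>Near a point \<open>x\<close> the polynomial factors of
  \<open>norm_zeta_summand_le\<close> are bounded, and \<open>Re s > 1/2\<close> makes the remaining
  power at most \<open>n powr (-3/2)\<close>: the series converges locally uniformly.\<close>

lemma pole_free_zeta_holomorphic: "pole_free_zeta holomorphic_on {s. Re s > 1/2}"
proof -
  let ?S = "{s. Re s > 1/2}"
  have S: "open ?S" by (rule open_halfspace_Re_gt)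
  have "\<exists>g g'. \<forall>x\<in>?S. ((\<lambda>n. zeta_summand n x) sums g x) \<and> ((\<lambda>n. deriv (zeta_summand n) x) sums g' x)
      \<and> (g has_field_derivative g' x) (at x)"
  proof (rule series_and_derivative_comparison_local[OF S])
    show "(zeta_summand n has_field_derivative deriv (zeta_summand n) x) (at x)" for n x
      using zeta_summand_holomorphic[of n UNIV] by (intro holomorphic_derivI[of _ UNIV]) auto
  next
    fix x assume "x \<in> ?S"
    define R where "R = norm x + 1"
    have "norm (zeta_summand n y) \<le> (R + 1) * R * real n powr (- (3/2))"
      if y: "y \<in> ball x 1 \<inter> ?S" and n: "n \<ge> 1" for n y
    proof -
      have "norm (y - x) < 1" using y by (auto simp: dist_norm norm_minus_commute)
      then have 1: "norm y \<le> R" using norm_triangle_ineq2[of y x] by (simp add: R_def)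
      have 2: "norm (y - 1) \<le> R + 1" using 1 norm_triangle_ineq4[of y 1] by simp
      have "norm (zeta_summand n y) \<le> norm (y - 1) * norm y * real n powr (- Re y - 1)"
        using y n by (intro norm_zeta_summand_le) auto
      also have "\<dots> \<le> (R + 1) * R * real n powr (- (3/2))"
        using 1 2 y n by (intro mult_mono powr_mono) (auto simp: R_def intro!: add_nonneg_nonneg mult_nonneg_nonneg)
      finally show ?thesis .
    qed
    then show "\<exists>d h. 0 < d \<and> summable h \<and> (\<forall>\<^sub>F n in sequentially. \<forall>y\<in>ball x d \<inter> ?S. norm (zeta_summand n y) \<le> h n)"
      by (intro exI[of _ 1] exI[of _ "\<lambda>n. (R + 1) * R * real n powr (- (3/2))"] conjI summable_mult eventually_sequentiallyI[of 1])
         (auto simp: summable_real_powr_iff)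
  qed
  then obtain g g' where g: "\<And>x. x \<in> ?S \<Longrightarrow> ((\<lambda>n. zeta_summand n x) sums g x) \<and> (g has_field_derivative g' x) (at x)"
    by blast
  have "g holomorphic_on ?S"
    unfolding holomorphic_on_open[OF S] using g by blast
  then show ?thesis
    by (rule holomorphic_transform) (use g in \<open>auto simp: pole_free_zeta_def sums_iff\<close>)
qed

lemma pole_free_zeta_eq:
  assumes "Re s > 1"
  shows "pole_free_zeta s = (s - 1) * zeta s"
proof -
  have "(\<lambda>n. of_nat n powr (1 - s) :: complex) \<longlonglongrightarrow> 0"
  proof (rule tendsto_norm_zero_cancel)
    have "((\<lambda>x. x powr (1 - Re s)) \<longlongrightarrow> 0) at_top"
      using assms by (intro tendsto_neg_powr) (auto simp: filterlim_ident)
    then have "(\<lambda>n. real n powr (1 - Re s)) \<longlonglongrightarrow> 0"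
      by (rule filterlim_compose) (rule filterlim_real_sequentially)
    then show "(\<lambda>n. norm (of_nat n powr (1 - s) :: complex)) \<longlonglongrightarrow> 0"
      by (simp add: norm_nat_powr)
  qed
  from telescope_sums[OF this]
  have "(\<lambda>n. of_nat (Suc n) powr (1 - s) - of_nat n powr (1 - s) :: complex) sums 0" by simp
  from sums_add[OF sums_mult[OF zeta_sums[OF assms], of "s - 1"] this]
  show ?thesis
    unfolding pole_free_zeta_def by (simp add: zeta_summand_def sums_iff algebra_simps)
qed

text \<open>The value is the residue of zeta at its pole. At \<open>s = 1\<close> every summand with
  \<open>n > 0\<close> becomes \<open>-1 + 1\<close>.\<close>

lemma pole_free_zeta_1: "pole_free_zeta 1 = 1"
proof -
  have "(\<lambda>n. zeta_summand n 1) sums (\<Sum>n\<in>{0}. zeta_summand n 1)"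
    by (intro sums_finite) (auto simp: zeta_summand_def of_nat_Suc[symmetric] simp del: of_nat_Suc)
  then show ?thesis by (simp add: pole_free_zeta_def sums_iff zeta_summand_def)
qed

text \<open>Kept free of division by \<open>pole_free_zeta s\<close>, since the non-vanishing of
  that value is itself deduced from this identity.\<close>

lemma deriv_pole_free_zeta:
  assumes "Re s > 1"
  shows "(s - 1) * deriv pole_free_zeta s = pole_free_zeta s * (1 - (s - 1) * mangoldt_series s)"
proof -
  have "((\<lambda>s. (s - 1) * zeta s) has_field_derivative (zeta s - (s - 1) * (mangoldt_series s * zeta s))) (at s)"
    by (auto intro!: derivative_eq_intros has_field_derivative_zeta assms)
  then have "(pole_free_zeta has_field_derivative (zeta s - (s - 1) * (mangoldt_series s * zeta s))) (at s)"
    by (rule has_field_derivative_transform_within_open[of _ _ _ "{s. Re s > 1}"])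
       (use assms in \<open>auto simp: pole_free_zeta_eq open_halfspace_Re_gt\<close>)
  then have "deriv pole_free_zeta s = zeta s - (s - 1) * (mangoldt_series s * zeta s)"
    by (rule DERIV_imp_deriv)
  then show ?thesis
    by (simp only: pole_free_zeta_eq[OF assms]) (simp add: algebra_simps)
qed

section \<open>Orders of vanishing and the non-vanishing of zeta\<close>

lemma holomorphic_on_imp_isCont:
  assumes "f holomorphic_on S" "open S" "z \<in> S"
  shows "isCont f z" "isCont (deriv f) z"
  using holomorphic_on_imp_continuous_on[OF assms(1)]
    holomorphic_on_imp_continuous_on[OF holomorphic_deriv[OF assms(1,2)]] assms(2,3)
  by (auto simp: continuous_on_eq_continuous_at)

text \<open>The limit \<open>m\<close> is the order of vanishing of \<open>f\<close> at \<open>z\<close>.\<close>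

lemma log_deriv_tendsto_order:
  assumes f: "f holomorphic_on S" and S: "open S" "connected S" and z: "z \<in> S" and w: "w \<in> S" "f w \<noteq> 0"
  obtains m :: nat where "m = 0 \<longleftrightarrow> f z \<noteq> 0"
    "((\<lambda>e. of_real e * (deriv f (z + of_real e) / f (z + of_real e))) \<longlongrightarrow> of_nat m) (at_right (0::real))"
proof -
  have lim: "((\<lambda>e. z + of_real e) \<longlongrightarrow> z) (at_right (0::real))"
    by (auto intro!: tendsto_eq_intros)
  show ?thesis
  proof (cases "f z = 0")
    case False
    have "isCont f z" "isCont (deriv f) z"
      using holomorphic_on_imp_isCont[OF f S(1) z] .
    then have "((\<lambda>e. of_real e * (deriv f (z + of_real e) / f (z + of_real e))) \<longlongrightarrow> of_real 0 * (deriv f z / f z)) (at_right (0::real))"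
      using isCont_tendsto_compose[OF _ lim, of f] isCont_tendsto_compose[OF _ lim, of "deriv f"] False
      by (intro tendsto_mult tendsto_divide tendsto_of_real tendsto_ident_at) auto
    then show ?thesis using False by (intro that[of 0]) auto
  next
    case True
    have "\<not> f constant_on S"
      using True z w unfolding constant_on_def by metis
    from True this obtain g r n where gr: "0 < n" "0 < r" "ball z r \<subseteq> S" "g holomorphic_on ball z r"
       and fg: "\<And>w. w \<in> ball z r \<Longrightarrow> f w = (w - z) ^ n * g w"
       and g0: "\<And>w. w \<in> ball z r \<Longrightarrow> g w \<noteq> 0"
      by (rule holomorphic_factor_zero_nonconstant[OF f S z]) (rule that; assumption)
    have "isCont g z" "isCont (deriv g) z"
      using holomorphic_on_imp_isCont[OF gr(4) open_ball, of z] gr(2) by auto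
    \<comment> \<open>From \<open>f w = (w - z) ^ n * g w\<close> the logarithmic derivative is
      \<open>n / (w - z)\<close> plus that of \<open>g\<close>. Multiplication by
      \<open>e = w - z\<close> leaves \<open>n\<close> plus a term tending to 0, as \<open>g\<close>
      has no zero at \<open>z\<close>.\<close>
    then have "((\<lambda>e. of_nat n + of_real e * (deriv g (z + of_real e) / g (z + of_real e))) \<longlongrightarrow>
         of_nat n + of_real 0 * (deriv g z / g z)) (at_right (0::real))"
      using isCont_tendsto_compose[OF _ lim, of g] isCont_tendsto_compose[OF _ lim, of "deriv g"] g0[of z] gr(2)
      by (intro tendsto_add tendsto_const tendsto_mult tendsto_divide tendsto_of_real tendsto_ident_at) auto
    then have lim2: "((\<lambda>e. of_nat n + of_real e * (deriv g (z + of_real e) / g (z + of_real e))) \<longlongrightarrow> of_nat n) (at_right (0::real))"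
      by simp
    have "\<forall>\<^sub>F e in at_right (0::real). e < r" "\<forall>\<^sub>F e in at_right (0::real). 0 < e"
      using gr(2) by (auto intro: eventually_at_rightI[of 0 r] eventually_at_right_less)
    then have "\<forall>\<^sub>F e in at_right (0::real). of_nat n + of_real e * (deriv g (z + of_real e) / g (z + of_real e))
         = of_real e * (deriv f (z + of_real e) / f (z + of_real e))"
    proof eventually_elim
      case (elim e)
      define x where "x = z + of_real e"
      have x: "x \<in> ball z r" using elim by (simp add: x_def dist_norm)
      have xz: "x - z = of_real e" "of_real e \<noteq> (0::complex)" using elim by (auto simp: x_def)
      have dg: "(g has_field_derivative deriv g x) (at x)"
        using gr x by (intro holomorphic_derivI[of _ "ball z r"]) auto
      have "((\<lambda>w. (w - z) ^ n * g w) has_field_derivative (of_nat n * (x - z) ^ (n - 1) * g x + (x - z) ^ n * deriv g x)) (at x)"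
        by (auto intro!: derivative_eq_intros dg)
      then have "(f has_field_derivative (of_nat n * (x - z) ^ (n - 1) * g x + (x - z) ^ n * deriv g x)) (at x)"
        by (rule has_field_derivative_transform_within_open[of _ _ _ "ball z r"]) (use x fg in auto)
      then have df: "deriv f x = of_nat n * (x - z) ^ (n - 1) * g x + (x - z) ^ n * deriv g x"
        by (rule DERIV_imp_deriv)
      have fx: "f x = (x - z) ^ n * g x" by (rule fg[OF x])
      obtain n' where n': "n = Suc n'" using gr(1) by (cases n) auto
      have "of_real e * (deriv f x / f x) = of_nat n + of_real e * (deriv g x / g x)"
        unfolding df fx xz n' using xz(2) g0[OF x] by (simp add: field_simps)
      then show ?case unfolding x_def by simp
    qed
    with lim2 have "((\<lambda>e. of_real e * (deriv f (z + of_real e) / f (z + of_real e))) \<longlongrightarrow> of_nat n) (at_right (0::real))"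
      by (rule Lim_transform_eventually)
    with gr True show ?thesis by (intro that[of n]) auto
  qed
qed

lemma pole_free_zeta_order:
  assumes "Re z > 1/2"
  obtains m :: nat where "m = 0 \<longleftrightarrow> pole_free_zeta z \<noteq> 0"
    "((\<lambda>e. of_real e * (deriv pole_free_zeta (z + of_real e) / pole_free_zeta (z + of_real e))) \<longlongrightarrow> of_nat m) (at_right (0::real))"
proof -
  have "connected {s. 1 / 2 < Re s}"
    by (intro convex_connected convex_halfspace_Re_gt)
  moreover have "z \<in> {s. 1 / 2 < Re s}" "1 \<in> {s. 1 / 2 < Re s}" "pole_free_zeta 1 \<noteq> 0"
    using assms by (auto simp: pole_free_zeta_1)
  ultimately show ?thesis
    by (rule log_deriv_tendsto_order[OF pole_free_zeta_holomorphic open_halfspace_Re_gt]) (rule that)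
qed

lemma norm_mangoldt_series_le:
  assumes "1 < a" "a \<le> Re s"
  shows "norm (mangoldt_series s) \<le> (\<Sum>n. mangoldt n * real n powr (-a))"
proof -
  have "norm (mangoldt_series s) \<le> (\<Sum>n. norm (mangoldt n * of_nat n powr (-s) :: complex))"
    unfolding mangoldt_series_def using assms by (intro summable_norm summable_norm_mangoldt_powr) auto
  also have "\<dots> \<le> (\<Sum>n. mangoldt n * real n powr (-a))"
  proof (rule suminf_le)
    fix n :: nat
    show "norm (mangoldt n * of_nat n powr (-s) :: complex) \<le> mangoldt n * real n powr (-a)"
    proof (cases "n = 0")
      case False
      then show ?thesis using assms
        by (auto simp: norm_mult norm_nat_powr mangoldt_nonneg intro!: mult_left_mono powr_mono)
    qed auto
  qed (use assms summable_norm_mangoldt_powr summable_mangoldt_powr in auto)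
  finally show ?thesis .
qed

text \<open>A zero at \<open>s\<close> would give \<open>e\<close> times the logarithmic derivative
  a positive limit. But to the right of \<open>s\<close> that derivative is
  \<open>1 / (x - 1) - mangoldt_series x\<close>, which stays bounded.\<close>

lemma pole_free_zeta_nonzero_gt_1:
  assumes "Re s > 1"
  shows "pole_free_zeta s \<noteq> 0"
proof
  assume 0: "pole_free_zeta s = 0"
  have "Re s > 1/2" using assms by simp
  then obtain m :: nat where m: "m = 0 \<longleftrightarrow> pole_free_zeta s \<noteq> 0"
    and lim: "((\<lambda>e. of_real e * (deriv pole_free_zeta (s + of_real e) / pole_free_zeta (s + of_real e))) \<longlongrightarrow> of_nat m) (at_right (0::real))"
    by (rule pole_free_zeta_order)
  define B where "B = 1 / (Re s - 1) + (\<Sum>n. mangoldt n * real n powr (- Re s))"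
  have "((\<lambda>e. of_real e * (deriv pole_free_zeta (s + of_real e) / pole_free_zeta (s + of_real e))) \<longlongrightarrow> 0) (at_right (0::real))"
  proof (rule Lim_null_comparison)
    show "((\<lambda>e. e * B) \<longlongrightarrow> 0) (at_right 0)"
      by (auto intro!: tendsto_eq_intros)
    show "\<forall>\<^sub>F e in at_right (0::real). norm (of_real e * (deriv pole_free_zeta (s + of_real e) / pole_free_zeta (s + of_real e))) \<le> e * B"
      using eventually_at_right_less[of "0::real"]
    proof eventually_elim
      case (elim e)
      define x where "x = s + of_real e"
      have Rx: "Re x \<ge> Re s" "Re x > 1" using elim assms by (auto simp: x_def)
      then have x1: "x \<noteq> 1" by auto
      have "Re s - 1 \<le> norm (x - 1)" using Rx complex_Re_le_cmod[of "x - 1"] by simp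
      then have 1: "norm (1 / (x - 1)) \<le> 1 / (Re s - 1)"
        using assms by (simp add: norm_divide frac_le)
      have 2: "norm (mangoldt_series x) \<le> (\<Sum>n. mangoldt n * real n powr (- Re s))"
        using Rx assms by (intro norm_mangoldt_series_le) auto
      have "norm (deriv pole_free_zeta x / pole_free_zeta x) \<le> B"
      proof (cases "pole_free_zeta x = 0")
        \<comment> \<open>At a zero the quotient is 0 by the convention for division, so the bound
          persists.\<close>
        case True
        then show ?thesis using 1 2 unfolding B_def
          using norm_ge_zero[of "1 / (x - 1)"] norm_ge_zero[of "mangoldt_series x"] by (simp only: True div_by_0 norm_zero)
      next
        case False
        have "deriv pole_free_zeta x / pole_free_zeta x = 1 / (x - 1) - mangoldt_series x"
          using deriv_pole_free_zeta[OF Rx(2)] x1 False by (simp add: field_simps)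
        then show ?thesis using 1 2 norm_triangle_ineq4[of "1 / (x - 1)" "mangoldt_series x"]
          unfolding B_def by simp
      qed
      then show ?case using elim by (simp add: x_def norm_mult del: times_divide_eq_right)
    qed
  qed
  with lim have "of_nat m = (0::complex)"
    by (rule tendsto_unique[rotated]) auto
  with m 0 show False by simp
qed

lemma mangoldt_series_eq:
  assumes "Re s > 1"
  shows "mangoldt_series s = 1 / (s - 1) - deriv pole_free_zeta s / pole_free_zeta s"
proof -
  have "s \<noteq> 1" using assms by auto
  then show ?thesis
    using deriv_pole_free_zeta[OF assms] pole_free_zeta_nonzero_gt_1[OF assms] by (simp add: field_simps)
qed

lemma Re_mangoldt_series_sums:
  assumes "a > 1"
  shows "(\<lambda>n. mangoldt n * real n powr (-a) * cos (t * ln (real n))) sums Re (mangoldt_series (Complex a t))"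
proof -
  have "Re (mangoldt n * of_nat n powr (- Complex a t)) = mangoldt n * real n powr (-a) * cos (t * ln (real n))" for n
  proof (cases "n = 0")
    case False
    then have "of_nat n powr (- Complex a t) = exp (- Complex a t * of_real (ln (real n)))"
      by (simp add: powr_def Ln_of_nat)
    then have "Re (of_nat n powr (- Complex a t)) = real n powr (-a) * cos (t * ln (real n))"
      using False by (simp add: Re_exp powr_def)
    then show ?thesis by simp
  qed auto
  then have "(\<lambda>n. Re (mangoldt n * of_nat n powr (- Complex a t))) = (\<lambda>n. mangoldt n * real n powr (-a) * cos (t * ln (real n)))"
    by (rule ext)
  then show ?thesis
    using sums_Re[OF mangoldt_series_sums[of "Complex a t"]] assms by (simp only: complex.sel)
qed

text \<open>Termwise this is \<open>3 + 4 * cos x + cos (2 * x) = 2 * (1 + cos x)\<^sup>2\<close> at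
  \<open>x = t * ln n\<close>, with non-negative weights.\<close>

lemma mangoldt_series_3_4_1:
  assumes "a > 1"
  shows "3 * Re (mangoldt_series (Complex a 0)) + 4 * Re (mangoldt_series (Complex a t)) + Re (mangoldt_series (Complex a (2 * t))) \<ge> 0"
proof -
  have s: "(\<lambda>n. 3 * (mangoldt n * real n powr (-a) * cos (0 * ln (real n))) + 4 * (mangoldt n * real n powr (-a) * cos (t * ln (real n)))
      + mangoldt n * real n powr (-a) * cos (2 * t * ln (real n))) sums
    (3 * Re (mangoldt_series (Complex a 0)) + 4 * Re (mangoldt_series (Complex a t)) + Re (mangoldt_series (Complex a (2 * t))))"
    using assms by (intro sums_add sums_mult Re_mangoldt_series_sums)
  show ?thesis
  proof (rule sums_le[OF _ sums_zero s])
    fix n :: nat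
    have "cos (2 * t * ln (real n)) = 2 * (cos (t * ln (real n)))\<^sup>2 - 1"
      using cos_double_cos[of "t * ln (real n)"] by (simp add: mult.assoc)
    note c = this
    have "3 * (mangoldt n * real n powr (-a) * cos (0 * ln (real n))) + 4 * (mangoldt n * real n powr (-a) * cos (t * ln (real n)))
      + mangoldt n * real n powr (-a) * cos (2 * t * ln (real n)) = mangoldt n * real n powr (-a) * (2 * (1 + cos (t * ln (real n)))\<^sup>2)"
      unfolding c by (simp add: algebra_simps power2_eq_square)
    also have "\<dots> \<ge> 0" by (intro mult_nonneg_nonneg mangoldt_nonneg) auto
    finally show "0 \<le> 3 * (mangoldt n * real n powr (-a) * cos (0 * ln (real n))) + 4 * (mangoldt n * real n powr (-a) * cos (t * ln (real n)))
      + mangoldt n * real n powr (-a) * cos (2 * t * ln (real n))" .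
  qed
qed

text \<open>By \<open>mangoldt_series_eq\<close>, the pole of \<open>1 / (s - 1)\<close> contributes
  1 exactly when \<open>t = 0\<close>, and the order of vanishing \<open>m\<close> of
  \<open>pole_free_zeta\<close> is subtracted.\<close>

lemma mangoldt_series_boundary_tendsto:
  obtains m :: nat where "m = 0 \<longleftrightarrow> pole_free_zeta (Complex 1 t) \<noteq> 0"
    "((\<lambda>e. e * Re (mangoldt_series (Complex (1 + e) t))) \<longlongrightarrow> (if t = 0 then 1 else 0) - real m) (at_right 0)"
proof -
  obtain m :: nat where m: "m = 0 \<longleftrightarrow> pole_free_zeta (Complex 1 t) \<noteq> 0"
    and lim: "((\<lambda>e. of_real e * (deriv pole_free_zeta (Complex 1 t + of_real e) / pole_free_zeta (Complex 1 t + of_real e))) \<longlongrightarrow> of_nat m) (at_right (0::real))"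
    by (rule pole_free_zeta_order[of "Complex 1 t"]) auto
  have eq: "Complex 1 t + of_real e = Complex (1 + e) t" for e
    by (simp add: complex_eq_iff)
  have "((\<lambda>e. of_real e * (1 / (Complex (1 + e) t - 1)) :: complex) \<longlongrightarrow> (if t = 0 then 1 else 0)) (at_right 0)"
  proof (cases "t = 0")
    case True
    have "\<forall>\<^sub>F e in at_right (0::real). 1 = (of_real e * (1 / (Complex (1 + e) t - 1)) :: complex)"
      using eventually_at_right_less[of "0::real"]
    proof eventually_elim
      case (elim e)
      have "Complex (1 + e) t - 1 = of_real e" using True by (simp add: complex_eq_iff)
      then show ?case using elim by simp
    qed
    then show ?thesis using True by (auto intro: Lim_transform_eventually[OF tendsto_const])
  next
    case False
    have "((\<lambda>e. of_real e * (1 / (Complex 1 t + of_real e - 1)) :: complex) \<longlongrightarrow> of_real 0 * (1 / (Complex 1 t + of_real 0 - 1))) (at_right 0)"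
      using False by (intro tendsto_intros) (auto simp: complex_eq_iff)
    then show ?thesis using False by (simp add: eq)
  qed
  from tendsto_Re[OF tendsto_diff[OF this lim]]
  have "((\<lambda>e. Re (of_real e * (1 / (Complex (1 + e) t - 1)) - of_real e * (deriv pole_free_zeta (Complex (1+e) t) / pole_free_zeta (Complex (1+e) t))))
     \<longlongrightarrow> (if t = 0 then 1 else 0) - real m) (at_right 0)"
    by (auto simp: eq split: if_splits)
  moreover have "\<forall>\<^sub>F e in at_right (0::real). Re (of_real e * (1 / (Complex (1 + e) t - 1)) - of_real e * (deriv pole_free_zeta (Complex (1+e) t) / pole_free_zeta (Complex (1+e) t)))
     = e * Re (mangoldt_series (Complex (1 + e) t))"
    using eventually_at_right_less[of "0::real"]
  proof eventually_elim
    case (elim e)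
    then have "Re (Complex (1 + e) t) > 1" by simp
    from mangoldt_series_eq[OF this] show ?case
      by (simp only: right_diff_distrib[symmetric]) simp
  qed
  ultimately have "((\<lambda>e. e * Re (mangoldt_series (Complex (1 + e) t))) \<longlongrightarrow> (if t = 0 then 1 else 0) - real m) (at_right 0)"
    by (rule Lim_transform_eventually)
  with m show ?thesis by (rule that)
qed

text \<open>On the line of real part one away from 1, multiply the 3-4-1 inequality by
  \<open>e\<close> and let \<open>e\<close> tend to 0. The orders \<open>m\<close> at
  \<open>1 + it\<close> and \<open>m2\<close> at \<open>1 + 2it\<close> satisfy
  \<open>0 \<le> 3 - 4 * m - m2\<close>, which forces \<open>m = 0\<close>.\<close>

lemma pole_free_zeta_nonzero:
  assumes "Re s \<ge> 1"
  shows "pole_free_zeta s \<noteq> 0"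
proof (cases "Re s > 1 \<or> Im s = 0")
  case True
  then show ?thesis
  proof
    assume "Im s = 0"
    then have "Re s > 1 \<or> s = 1" using assms by (auto simp: complex_eq_iff)
    then show ?thesis using pole_free_zeta_nonzero_gt_1 pole_free_zeta_1 by auto
  qed (rule pole_free_zeta_nonzero_gt_1)
next
  case False
  define t where "t = Im s"
  have s: "s = Complex 1 t" and t: "t \<noteq> 0" using False assms by (auto simp: t_def complex_eq_iff)
  let ?L = "\<lambda>t e. e * Re (mangoldt_series (Complex (1 + e) t))"
  obtain m0 :: nat where m0: "m0 = 0 \<longleftrightarrow> pole_free_zeta (Complex 1 0) \<noteq> 0"
    "(?L 0 \<longlongrightarrow> 1 - real m0) (at_right 0)"
    by (rule mangoldt_series_boundary_tendsto[of 0]) auto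
  have "Complex 1 0 = 1" by (simp add: complex_eq_iff)
  with m0 have m0: "(?L 0 \<longlongrightarrow> 1) (at_right 0)" by (simp add: pole_free_zeta_1)
  obtain m :: nat where m: "m = 0 \<longleftrightarrow> pole_free_zeta (Complex 1 t) \<noteq> 0" "(?L t \<longlongrightarrow> 0 - real m) (at_right 0)"
    by (rule mangoldt_series_boundary_tendsto[of t]) (use t in auto)
  obtain m2 :: nat where m2: "(?L (2 * t) \<longlongrightarrow> 0 - real m2) (at_right 0)"
    by (rule mangoldt_series_boundary_tendsto[of "2 * t"]) (use t in auto)
  have "((\<lambda>e. 3 * ?L 0 e + 4 * ?L t e + ?L (2 * t) e) \<longlongrightarrow> 3 * 1 + 4 * (0 - real m) + (0 - real m2)) (at_right 0)"
    by (intro tendsto_intros m0 m m2)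
  moreover have "\<forall>\<^sub>F e in at_right (0::real). 0 \<le> 3 * ?L 0 e + 4 * ?L t e + ?L (2 * t) e"
    using eventually_at_right_less[of "0::real"]
  proof eventually_elim
    case (elim e)
    have "0 \<le> e * (3 * Re (mangoldt_series (Complex (1 + e) 0)) + 4 * Re (mangoldt_series (Complex (1 + e) t)) + Re (mangoldt_series (Complex (1 + e) (2 * t))))"
      using elim by (intro mult_nonneg_nonneg mangoldt_series_3_4_1) auto
    then show ?case by (simp add: algebra_simps)
  qed
  ultimately have "0 \<le> 3 * 1 + 4 * (0 - real m) + (0 - real m2)"
    by (intro tendsto_lowerbound) auto
  moreover have "0 \<le> real m2" by simp
  ultimately have "real m < 1" by argo
  then have "m = 0" by simp
  with m s show ?thesis by simp
qed

text \<open>The continuous extension of \<open>- \<zeta>'/\<zeta> - \<zeta>\<close> to the closed half plane: the two simple poles at \<open>1\<close> cancel.\<close>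

definition zeta_difference :: "complex \<Rightarrow> complex" where
  "zeta_difference s = - (deriv pole_free_zeta s / pole_free_zeta s)
     - (if s = 1 then deriv pole_free_zeta 1 else (pole_free_zeta s - 1) / (s - 1))"

lemma zeta_difference_eq:
  assumes "Re s > 1"
  shows "zeta_difference s = mangoldt_series s - zeta s"
proof -
  have "s \<noteq> 1" using assms by auto
  then show ?thesis
    using assms by (simp add: zeta_difference_def mangoldt_series_eq) (simp add: pole_free_zeta_eq field_simps)
qed

lemma zeta_difference_sums:
  assumes "Re s > 1"
  shows "(\<lambda>n. (mangoldt n - 1) * of_nat n powr (-s)) sums zeta_difference s"
  using sums_diff[OF mangoldt_series_sums[OF assms] zeta_sums[OF assms]]
  by (simp add: zeta_difference_eq[OF assms] left_diff_distrib)

lemma continuous_on_zeta_difference: "continuous_on {s. Re s \<ge> 1} zeta_difference"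
proof -
  let ?S = "{s. Re s > 1/2}"
  have S: "open ?S" by (rule open_halfspace_Re_gt)
  have c1: "continuous_on ?S pole_free_zeta" "continuous_on ?S (deriv pole_free_zeta)"
    using pole_free_zeta_holomorphic S by (auto intro: holomorphic_on_imp_continuous_on holomorphic_deriv)
  \<comment> \<open>A removable singularity: the difference quotient at 1, completed by the
    derivative, is holomorphic.\<close>
  have c2: "continuous_on ?S (\<lambda>s. if s = 1 then deriv pole_free_zeta 1 else (pole_free_zeta s - pole_free_zeta 1) / (s - 1))"
    by (rule holomorphic_on_imp_continuous_on, rule pole_lemma_open[OF pole_free_zeta_holomorphic S])
  have c3: "continuous_on ?S (\<lambda>s. if s = 1 then deriv pole_free_zeta 1 else (pole_free_zeta s - 1) / (s - 1))"
    using c2 unfolding pole_free_zeta_1 .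
  have sub: "{s. Re s \<ge> 1} \<subseteq> ?S" by auto
  show ?thesis
    unfolding zeta_difference_def
    by (intro continuous_intros continuous_on_subset[OF c3 sub] continuous_on_subset[OF c1(1) sub] continuous_on_subset[OF c1(2) sub])
       (auto simp: pole_free_zeta_nonzero)
qed

section \<open>A Fejer-kernel Tauberian argument\<close>

text \<open>A triangle weight meant for \<open>{-T..T}\<close>. It turns negative outside and is
  truncated where a function on the whole line is wanted.\<close>

definition fejer_hat :: "real \<Rightarrow> real \<Rightarrow> real" where
  "fejer_hat T t = 1 - \<bar>t\<bar> / T"

text \<open>The Fourier transform of the triangle: \<open>T\<close> times the square of
  \<open>sin (T*y/2) / (T*y/2)\<close>, continued by \<open>T\<close> at 0.\<close>

definition fejer :: "real \<Rightarrow> real \<Rightarrow> real" where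
  "fejer T y = (if y = 0 then T else 2 * (1 - cos (T * y)) / (T * y\<^sup>2))"

lemma has_integral_fejer_half:
  assumes "T > 0" "y \<noteq> 0"
  shows "((\<lambda>t. of_real (1 - t / T) * cis (t * y)) has_integral
    (1 / (of_real T * of_real y ^ 2) - cis (T * y) / (of_real T * of_real y ^ 2) - 1 / (\<i> * of_real y))) {0..T}"
proof -
  \<comment> \<open>An antiderivative obtained by integration by parts.\<close>
  define F where "F = (\<lambda>t::real. of_real (1 - t / T) * cis (t * y) / (\<i> * of_real y) - cis (t * y) / (of_real T * of_real y ^ 2))"
  have cis: "((\<lambda>t. cis (t * y)) has_vector_derivative (\<i> * of_real y * cis (t * y))) (at t within {0..T})" for t
    by (auto intro!: derivative_eq_intros simp: has_vector_derivative_complex_iff algebra_simps)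
  have lin: "((\<lambda>t. of_real (1 - t / T) :: complex) has_vector_derivative of_real (- 1 / T)) (at t within {0..T})" for t
    using assms by (intro has_vector_derivative_of_real) (auto intro!: derivative_eq_intros)
  have "((\<lambda>t. of_real (1 - t / T) * cis (t * y)) has_integral (F T - F 0)) {0..T}"
  proof (rule fundamental_theorem_of_calculus)
    fix t assume "t \<in> {0..T}"
    have "(F has_vector_derivative
        ((of_real (1 - t / T) * (\<i> * of_real y * cis (t * y)) + of_real (- 1 / T) * cis (t * y)) / (\<i> * of_real y)
          - (\<i> * of_real y * cis (t * y)) / (of_real T * of_real y ^ 2))) (at t within {0..T})"
      unfolding F_def by (intro has_vector_derivative_diff has_vector_derivative_divide has_vector_derivative_mult cis lin)
    also have "(of_real (1 - t / T) * (\<i> * of_real y * cis (t * y)) + of_real (- 1 / T) * cis (t * y)) / (\<i> * of_real y)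
          - (\<i> * of_real y * cis (t * y)) / (of_real T * of_real y ^ 2) = of_real (1 - t / T) * cis (t * y)"
    proof -
      have "of_real y \<noteq> (0::complex)" "of_real T \<noteq> (0::complex)" using assms by auto
      then show ?thesis
        by (simp add: field_simps power2_eq_square)
    qed
    finally show "(F has_vector_derivative of_real (1 - t / T) * cis (t * y)) (at t within {0..T})" .
  qed (use assms in auto)
  also have "F T - F 0 = 1 / (of_real T * of_real y ^ 2) - cis (T * y) / (of_real T * of_real y ^ 2) - 1 / (\<i> * of_real y)"
    using assms by (simp add: F_def)
  finally show ?thesis .
qed

text \<open>The integral over \<open>{-T..0}\<close> is the half-range integral reflected, with
  \<open>y\<close> negated; adding both halves cancels the terms
  \<open>1 / (\<i> * y)\<close>.\<close>

lemma has_integral_fejer: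
  assumes "T > 0"
  shows "((\<lambda>t. of_real (fejer_hat T t) * cis (t * y)) has_integral of_real (fejer T y)) {-T..T}"
proof (cases "y = 0")
  case True
  have "((\<lambda>t. 1 - t / T) has_integral ((\<lambda>t. t - t^2 / (2*T)) T - (\<lambda>t. t - t^2 / (2*T)) 0)) {0..T}"
    using assms by (intro fundamental_theorem_of_calculus)
      (auto intro!: derivative_eq_intros simp: has_real_derivative_iff_has_vector_derivative[symmetric])
  then have "((\<lambda>t. 1 - t / T) has_integral T / 2) {0..T}"
    using assms by (simp add: power2_eq_square)
  then have 1: "((\<lambda>t. fejer_hat T t) has_integral T / 2) {0..T}"
    by (rule has_integral_eq[rotated]) (auto simp: fejer_hat_def)
  then have "((\<lambda>t. fejer_hat T (-t)) has_integral T / 2) {-T..-0}"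
    by (subst has_integral_reflect_real) auto
  then have 2: "((\<lambda>t. fejer_hat T t) has_integral T / 2) {-T..0}"
    by (simp add: fejer_hat_def)
  have "((\<lambda>t. fejer_hat T t) has_integral T / 2 + T / 2) {-T..T}"
    using assms by (intro has_integral_combine[OF _ _ 2 1]) auto
  from has_integral_of_real[OF this, where ?'b=complex] show ?thesis using True by (simp add: fejer_def)
next
  case False
  have 1: "((\<lambda>t. of_real (fejer_hat T t) * cis (t * y)) has_integral
    (1 / (of_real T * of_real y ^ 2) - cis (T * y) / (of_real T * of_real y ^ 2) - 1 / (\<i> * of_real y))) {0..T}"
    using has_integral_fejer_half[OF assms False] by (rule has_integral_eq[rotated]) (auto simp: fejer_hat_def)
  have "((\<lambda>t. of_real (1 - t / T) * cis (t * (-y))) has_integral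
    (1 / (of_real T * of_real (-y) ^ 2) - cis (T * (-y)) / (of_real T * of_real (-y) ^ 2) - 1 / (\<i> * of_real (-y)))) {0..T}"
    using has_integral_fejer_half[OF assms, of "-y"] False by simp
  then have "((\<lambda>t. of_real (1 - (-t) / T) * cis ((-t) * (-y))) has_integral
    (1 / (of_real T * of_real (-y) ^ 2) - cis (T * (-y)) / (of_real T * of_real (-y) ^ 2) - 1 / (\<i> * of_real (-y)))) {-T..-0}"
    by (subst has_integral_reflect_real)
  note 3 = this[unfolded minus_zero]
  have 2: "((\<lambda>t. of_real (fejer_hat T t) * cis (t * y)) has_integral
    (1 / (of_real T * of_real (-y) ^ 2) - cis (T * (-y)) / (of_real T * of_real (-y) ^ 2) - 1 / (\<i> * of_real (-y)))) {-T..0}"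
    by (rule has_integral_eq[OF _ 3]) (auto simp: fejer_hat_def)
  have "((\<lambda>t. of_real (fejer_hat T t) * cis (t * y)) has_integral
    (1 / (of_real T * of_real (-y) ^ 2) - cis (T * (-y)) / (of_real T * of_real (-y) ^ 2) - 1 / (\<i> * of_real (-y))) +
    (1 / (of_real T * of_real y ^ 2) - cis (T * y) / (of_real T * of_real y ^ 2) - 1 / (\<i> * of_real y))) {-T..T}"
    using assms by (intro has_integral_combine[OF _ _ 2 1]) auto
  also have "(1 / (of_real T * of_real (-y) ^ 2) - cis (T * (-y)) / (of_real T * of_real (-y) ^ 2) - 1 / (\<i> * of_real (-y))) +
    (1 / (of_real T * of_real y ^ 2) - cis (T * y) / (of_real T * of_real y ^ 2) - 1 / (\<i> * of_real y)) = 
    (2 - (cis (T * y) + cis (- (T * y)))) / (of_real T * of_real y ^ 2)"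
    by (simp add: add_divide_distrib diff_divide_distrib)
  also have "cis (T * y) + cis (- (T * y)) = of_real (2 * cos (T * y))"
    by (simp add: complex_eq_iff)
  also have "(2 - of_real (2 * cos (T * y))) / (of_real T * of_real y ^ 2) = (of_real (fejer T y) :: complex)"
    using False by (simp add: fejer_def)
  finally show ?thesis .
qed

lemma fejer_nonneg: "T > 0 \<Longrightarrow> fejer T y \<ge> 0"
  by (auto simp: fejer_def)

lemma fejer_le_inverse_square: "T > 0 \<Longrightarrow> y \<noteq> 0 \<Longrightarrow> fejer T y \<le> 4 / (T * y\<^sup>2)"
proof -
  assume "T > 0" "y \<noteq> 0"
  moreover have "2 * (1 - cos (T * y)) \<le> 4" using cos_ge_minus_one[of "T * y"] by argo
  ultimately show ?thesis unfolding fejer_def by (simp only: if_False) (rule divide_right_mono, auto)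
qed

lemma fejer_hat_bounds: "T > 0 \<Longrightarrow> \<bar>t\<bar> \<le> T \<Longrightarrow> 0 \<le> fejer_hat T t \<and> fejer_hat T t \<le> 1"
  by (auto simp: fejer_hat_def)

lemma has_integral_fejer_cos:
  assumes "T > 0"
  shows "((\<lambda>t. fejer_hat T t * cos (t * y)) has_integral fejer T y) {-T..T}"
  using has_integral_Re[OF has_integral_fejer[OF assms, of y]] by simp

lemma has_integral_fejer_hat:
  assumes "T > 0"
  shows "(fejer_hat T has_integral T) {-T..T}"
  using has_integral_fejer_cos[OF assms, of 0] by (simp add: fejer_def)

lemma fejer_le:
  assumes "T > 0"
  shows "fejer T y \<le> T"
proof (rule has_integral_le[OF has_integral_fejer_cos[OF assms] has_integral_fejer_hat[OF assms]])
  fix t assume "t \<in> {-T..T}"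
  then show "fejer_hat T t * cos (t * y) \<le> fejer_hat T t"
    using fejer_hat_bounds[OF assms, of t] by (intro mult_left_le) auto
qed

lemma cos_ge_half:
  fixes x :: real
  assumes "\<bar>x\<bar> \<le> 1"
  shows "cos x \<ge> 1 / 2"
proof -
  have "cos (pi / 3) \<le> cos \<bar>x\<bar>"
    using assms pi_gt3 by (intro cos_monotone_0_pi_le) auto
  then show ?thesis by (simp add: cos_60)
qed

text \<open>The phase \<open>t * y\<close> stays in \<open>[-1, 1]\<close>, where the cosine is at
  least 1/2, so at least half of the integral of the triangle survives.\<close>

lemma fejer_ge:
  assumes T: "T > 0" and y: "\<bar>y\<bar> \<le> 1 / T"
  shows "fejer T y \<ge> T / 2"
proof -
  have "((\<lambda>t. fejer_hat T t * (1 / 2)) has_integral T * (1 / 2)) {-T..T}"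
    using has_integral_fejer_hat[OF T] by (rule has_integral_mult_left)
  then have "T * (1 / 2) \<le> fejer T y"
  proof (rule has_integral_le[OF _ has_integral_fejer_cos[OF T, of y]])
    fix t assume t: "t \<in> {-T..T}"
    have "\<bar>t * y\<bar> \<le> T * (1 / T)"
      unfolding abs_mult using t y T by (intro mult_mono) auto
    then have "cos (t * y) \<ge> 1 / 2" using T by (intro cos_ge_half) auto
    then show "fejer_hat T t * (1 / 2) \<le> fejer_hat T t * cos (t * y)"
      using t T fejer_hat_bounds[of T t] by (intro mult_left_mono) auto
  qed
  then show ?thesis by simp
qed

lemma continuous_on_fejer_hat: "continuous_on A (fejer_hat T)"
proof -
  have "continuous_on A (\<lambda>t. 1 - \<bar>t\<bar> * inverse T)"
    by (intro continuous_intros)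
  then show ?thesis by (simp add: fejer_hat_def[abs_def] field_class.field_divide_inverse)
qed

section \<open>Kernel sums and the passage to the line of real part one\<close>

lemma zeta_difference_cis_sums:
  assumes "a > 1"
  shows "(\<lambda>n. of_real ((mangoldt n - 1) * real n powr (-a)) * cis (t * ln (real n))) sums zeta_difference (Complex a (-t))"
proof -
  have "(mangoldt n - 1) * of_nat n powr (- Complex a (-t)) =
      of_real ((mangoldt n - 1) * real n powr (-a)) * cis (t * ln (real n))" for n
  proof (cases "n = 0")
    case False
    then have "of_nat n powr (- Complex a (-t)) = exp (- Complex a (-t) * of_real (ln (real n)))"
      by (simp add: powr_def Ln_of_nat)
    also have "- Complex a (-t) * of_real (ln (real n)) = of_real (- a * ln (real n)) + \<i> * of_real (t * ln (real n))"
      by (simp add: complex_eq_iff)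
    also have "exp \<dots> = of_real (real n powr (-a)) * cis (t * ln (real n))"
      using False by (simp only: exp_add cis_conv_exp exp_of_real) (simp add: powr_def)
    finally show ?thesis by simp
  qed auto
  then have eq: "(\<lambda>n. (mangoldt n - 1) * of_nat n powr (- Complex a (-t))) =
     (\<lambda>n. of_real ((mangoldt n - 1) * real n powr (-a)) * cis (t * ln (real n)))"
    by (rule ext)
  from zeta_difference_sums[of "Complex a (-t)"] assms show ?thesis
    unfolding eq by simp
qed

text \<open>For \<open>a > 1\<close> the Dirichlet series converges uniformly in \<open>t\<close> by
  the M-test, so it may be integrated termwise against the triangle; each term yields the kernel at
  \<open>ln n - Y\<close>.\<close>

lemma fejer_sum_eq_integral:
  assumes a: "a > 1" and T: "T > 0"
  shows "(\<lambda>n. of_real ((mangoldt n - 1) * real n powr (-a) * fejer T (ln (real n) - Y))) sums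
    integral {-T..T} (\<lambda>t. of_real (fejer_hat T t) * cis (- t * Y) * zeta_difference (Complex a (-t)))"
proof -
  define c where "c = (\<lambda>n. (mangoldt n - 1) * real n powr (-a))"
  define f where "f = (\<lambda>n t. of_real (c n) * (of_real (fejer_hat T t) * cis (t * (ln (real n) - Y))))"
  define g where "g = (\<lambda>t. of_real (fejer_hat T t) * cis (- t * Y) * zeta_difference (Complex a (-t)))"
  have fint: "(f n has_integral of_real (c n * fejer T (ln (real n) - Y))) {-T..T}" for n
    unfolding f_def of_real_mult by (intro has_integral_mult_right has_integral_fejer T)
  have fsum: "(\<lambda>n. f n t) sums g t" for t
  proof -
    have "(\<lambda>n. (of_real (fejer_hat T t) * cis (- t * Y)) * (of_real (c n) * cis (t * ln (real n)))) sums g t"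
      unfolding g_def c_def by (intro sums_mult zeta_difference_cis_sums a)
    also have "(\<lambda>n. (of_real (fejer_hat T t) * cis (- t * Y)) * (of_real (c n) * cis (t * ln (real n)))) = (\<lambda>n. f n t)"
      unfolding f_def by (simp add: cis_mult algebra_simps)
    finally show ?thesis .
  qed
  have "uniform_limit {-T..T} (\<lambda>n t. \<Sum>i<n. f i t) (\<lambda>t. \<Sum>i. f i t) sequentially"
  proof (rule Weierstrass_m_test)
    fix n t assume "t \<in> {-T..T}"
    then have "\<bar>fejer_hat T t\<bar> \<le> 1" using fejer_hat_bounds[OF T, of t] by auto
    then have "norm (f n t) \<le> \<bar>c n\<bar> * (1 * 1)"
      unfolding f_def norm_mult by (intro mult_mono) auto
    also have "\<bar>c n\<bar> \<le> (mangoldt n + 1) * real n powr (-a)"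
      unfolding c_def abs_mult using mangoldt_nonneg[of n] by (intro mult_mono) auto
    finally show "norm (f n t) \<le> mangoldt n * real n powr (-a) + real n powr (-a)"
      by (simp add: algebra_simps)
  next
    show "summable (\<lambda>n. mangoldt n * real n powr (-a) + real n powr (-a))"
      using a by (intro summable_add summable_mangoldt_powr) (auto simp: summable_real_powr_iff)
  qed
  also have "(\<lambda>t. \<Sum>i. f i t) = g"
    using fsum by (auto simp: sums_iff)
  finally have u: "uniform_limit {-T..T} (\<lambda>n t. \<Sum>i<n. f i t) g sequentially" .
  have "continuous_on {-T..T} (\<lambda>t. \<Sum>i<n. f i t)" for n
    unfolding f_def by (intro continuous_intros continuous_on_fejer_hat)
  then obtain I J where IJ: "\<And>n. ((\<lambda>t. \<Sum>i<n. f i t) has_integral I n) {-T..T}" "(g has_integral J) {-T..T}"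
      "I \<longlonglongrightarrow> J"
    using uniform_limit_integral[OF u] sequentially_bot by metis
  have "I n = (\<Sum>i<n. of_real (c i * fejer T (ln (real i) - Y)))" for n
    using IJ(1)[of n] by (rule has_integral_unique) (intro has_integral_sum fint finite_lessThan)
  then have "I = (\<lambda>n. \<Sum>i<n. of_real (c i * fejer T (ln (real i) - Y)))" by (rule ext)
  moreover have "J = integral {-T..T} g" using IJ(2) by (simp add: integral_unique)
  ultimately show ?thesis using IJ(3) unfolding sums_def c_def g_def by simp
qed

text \<open>For continuous \<open>f\<close> of compact support the integral is controlled by the
  modulus of continuity of \<open>f\<close> at half a period, \<open>pi / Y\<close>.\<close>

lemma riemann_lebesgue:
  fixes f :: "real \<Rightarrow> complex"
  assumes f: "continuous_on UNIV f" and T: "T > 0" and supp: "\<And>t. \<bar>t\<bar> \<ge> T \<Longrightarrow> f t = 0"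
  shows "((\<lambda>Y. integral {-T..T} (\<lambda>t. f t * cis (- t * Y))) \<longlongrightarrow> 0) at_top"
proof (rule tendstoI)
  fix e :: real assume e: "e > 0"
  \<comment> \<open>The radius leaves room beyond the support for a shift by less than 1; with
    \<open>e'\<close> below, twice the integral is at most \<open>e\<close>.\<close>
  define R where "R = T + 1"
  define e' where "e' = e / (2 * R)"
  have R: "R > 0" and e': "e' > 0" using T e by (auto simp: R_def e'_def)
  have "uniformly_continuous_on {-(R+1)..R+1} f"
    using f by (intro compact_uniformly_continuous) (auto intro: continuous_on_subset)
  then obtain d where d: "d > 0" "\<And>x y. x \<in> {-(R+1)..R+1} \<Longrightarrow> y \<in> {-(R+1)..R+1} \<Longrightarrow> dist y x < d \<Longrightarrow> dist (f y) (f x) < e'"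
    using e' unfolding uniformly_continuous_on_def by blast
  have "norm (integral {-T..T} (\<lambda>t. f t * cis (- t * Y))) < e" if Y: "Y > pi / min 1 d" for Y
  proof -
    have "min 1 d > 0" using d by simp
    then have Y0: "Y > 0" using Y pi_gt_zero by (meson divide_pos_pos less_trans)
    define b where "b = pi / Y"
    have "b > 0" using Y0 by (simp add: b_def)
    moreover have "b < min 1 d"
      using Y Y0 \<open>min 1 d > 0\<close> unfolding b_def by (simp only: pos_divide_less_eq mult.commute)
    ultimately have b: "b > 0" "b < 1" "b < d" by auto
    define g where "g = (\<lambda>t. f t * cis (- t * Y))"
    have cg: "continuous_on A g" for A
      unfolding g_def by (intro continuous_intros continuous_on_subset[OF f]) auto
    have sup: "integral {l..u} g = integral {-T..T} g" if "l \<le> -T" "T \<le> u" for l u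
    proof (rule integral_unique)
      have "(g has_integral integral {-T..T} g) {-T..T}"
        by (intro integrable_integral integrable_continuous_interval cg)
      then show "(g has_integral integral {-T..T} g) {l..u}"
        by (rule has_integral_on_superset) (use that supp in \<open>auto simp: g_def\<close>)
    qed
    have shift: "integral {-R..R} (\<lambda>t. g (t + b)) = integral {-T..T} g"
    proof -
      have "integral {-R..R} (g \<circ> (\<lambda>t. t + b)) = integral {-R+b..R+b} g"
        by (rule integral_shift) (rule cg)
      also have "\<dots> = integral {-T..T} g" using b by (intro sup) (auto simp: R_def)
      finally show ?thesis by (simp add: o_def)
    qed
    \<comment> \<open>A shift by half a period flips the sign of the oscillating factor, so twice the integral is an
      integral of \<open>f t - f (t + b)\<close>.\<close>
    have gb: "g (t + b) = - (f (t + b) * cis (- t * Y))" for t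
    proof -
      have "- (t + b) * Y = - t * Y + (- pi)" using Y0 by (simp add: b_def field_simps)
      then have "cis (- (t + b) * Y) = cis (- t * Y) * cis (- pi)" by (simp only: cis_mult)
      also have "cis (- pi) = -1" by (simp add: complex_eq_iff)
      finally have "cis (- (t + b) * Y) = - cis (- t * Y)" by simp
      then show ?thesis by (simp only: g_def mult_minus_right)
    qed
    have "2 * integral {-T..T} g = integral {-R..R} g + integral {-R..R} (\<lambda>t. g (t + b))"
      using shift sup[of "-R" R] by (simp add: R_def)
    also have "\<dots> = integral {-R..R} (\<lambda>t. g t + g (t + b))"
      by (intro integral_add[symmetric] integrable_continuous_interval cg continuous_on_compose2[OF cg[of UNIV]] continuous_intros) auto
    also have "norm \<dots> \<le> e' * (R - (-R))"
    proof (rule integral_bound)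
      show "continuous_on {-R..R} (\<lambda>t. g t + g (t + b))"
        by (intro cg continuous_intros continuous_on_compose2[OF cg[of UNIV]]) auto
    next
      fix t assume t: "t \<in> {-R..R}"
      have "g t + g (t + b) = (f t - f (t + b)) * cis (- t * Y)"
        unfolding gb by (simp add: g_def algebra_simps)
      moreover have "norm (f t - f (t + b)) < e'"
        using d(2)[of "t + b" t] t b by (auto simp: dist_norm)
      ultimately show "norm (g t + g (t + b)) \<le> e'" by (simp add: norm_mult)
    qed (use R in auto)
    also have "\<dots> = e" using R by (simp add: e'_def)
    finally have "2 * norm (integral {-T..T} g) \<le> e" by (simp add: norm_mult)
    then show ?thesis using e by (simp add: g_def)
  qed
  then have "\<forall>\<^sub>F Y in at_top. norm (integral {-T..T} (\<lambda>t. f t * cis (- t * Y))) < e"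
    by (intro eventually_mono[OF eventually_gt_at_top[of "pi / min 1 d"]])
  then show "\<forall>\<^sub>F Y in at_top. dist (integral {-T..T} (\<lambda>t. f t * cis (- t * Y))) 0 < e"
    by (simp only: dist_norm diff_zero)
qed

text \<open>The order of the limits matters: first \<open>Y\<close> is taken large, using the
  integral at \<open>a = 1\<close>, and only then is \<open>a\<close> moved close to 1, depending on
  \<open>Y\<close>.\<close>

lemma fejer_sum_small:
  assumes T: "T > 0" and e: "e > 0"
  shows "\<forall>\<^sub>F Y in at_top. \<forall>\<^sub>F a in at_right 1.
    \<bar>\<Sum>n. (mangoldt n - 1) * real n powr (-a) * fejer T (ln (real n) - Y)\<bar> < e"
proof -
  define J where "J = (\<lambda>a Y. integral {-T..T} (\<lambda>t. of_real (fejer_hat T t) * cis (- t * Y) * zeta_difference (Complex a (-t))))"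
  \<comment> \<open>Truncating the triangle at 0 gives a continuous function on the whole line that
    vanishes outside \<open>{-T..T}\<close>.\<close>
  define H where "H = (\<lambda>t. of_real (max 0 (fejer_hat T t)) * zeta_difference (Complex 1 (-t)))"
  have contG: "continuous_on A (\<lambda>t. zeta_difference (Complex a (-t)))" if "a \<ge> 1" for a A
  proof -
    have "continuous_on A (\<lambda>t. Complex a (-t))"
      by (intro continuous_intros)
    then show ?thesis
      by (rule continuous_on_compose2[OF continuous_on_zeta_difference]) (use that in auto)
  qed
  have "((\<lambda>Y. integral {-T..T} (\<lambda>t. H t * cis (- t * Y))) \<longlongrightarrow> 0) at_top"
  proof (rule riemann_lebesgue)
    show "continuous_on UNIV H"
      unfolding H_def by (intro continuous_intros contG continuous_on_fejer_hat) auto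
    fix t assume "\<bar>t\<bar> \<ge> T"
    then have "fejer_hat T t \<le> 0" using T by (simp add: fejer_hat_def)
    then show "H t = 0" by (simp add: H_def)
  qed (rule T)
  moreover have "integral {-T..T} (\<lambda>t. H t * cis (- t * Y)) = J 1 Y" for Y
    unfolding J_def
  proof (rule integral_cong)
    fix t assume "t \<in> {-T..T}"
    then have "max 0 (fejer_hat T t) = fejer_hat T t" using fejer_hat_bounds[OF T, of t] by auto
    then show "H t * cis (- t * Y) = of_real (fejer_hat T t) * cis (- t * Y) * zeta_difference (Complex 1 (-t))"
      by (simp add: H_def)
  qed
  ultimately have "((\<lambda>Y. J 1 Y) \<longlongrightarrow> 0) at_top" by simp
  then have "\<forall>\<^sub>F Y in at_top. norm (J 1 Y) < e / 2"
    using e by (auto dest!: tendstoD[where e="e/2"])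
  then show ?thesis
  proof eventually_elim
    case (elim Y)
    \<comment> \<open>A compact rectangle containing all the segments of integration for
      \<open>a\<close> between 1 and 2; uniform continuity there compares \<open>J a Y\<close> with
      \<open>J 1 Y\<close>.\<close>
    define K where "K = cbox (Complex 1 (-T)) (Complex 2 T)"
    have "uniformly_continuous_on K zeta_difference"
      unfolding K_def
      by (intro compact_uniformly_continuous continuous_on_subset[OF continuous_on_zeta_difference]) (auto simp: in_cbox_complex_iff)
    moreover have "e / (8 * T) > 0" using e T by simp
    ultimately obtain d where d: "d > 0"
      "\<And>x y. x \<in> K \<Longrightarrow> y \<in> K \<Longrightarrow> dist y x < d \<Longrightarrow> dist (zeta_difference y) (zeta_difference x) < e / (8 * T)"
      unfolding uniformly_continuous_on_def by blast
    have "\<forall>\<^sub>F a in at_right (1::real). a \<in> {1<..<min 2 (1 + d)}"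
      using d by (intro eventually_at_rightI[of 1 "min 2 (1 + d)"]) auto
    then show ?case
    proof eventually_elim
      case (elim a)
      have intb: "(\<lambda>t. of_real (fejer_hat T t) * cis (- t * Y) * zeta_difference (Complex a (-t))) integrable_on {-T..T}" if "a \<ge> 1" for a
        by (intro integrable_continuous_interval continuous_intros contG continuous_on_fejer_hat that)
      have "J a Y - J 1 Y = integral {-T..T} (\<lambda>t. of_real (fejer_hat T t) * cis (- t * Y) * zeta_difference (Complex a (-t))
           - of_real (fejer_hat T t) * cis (- t * Y) * zeta_difference (Complex 1 (-t)))"
        unfolding J_def using elim by (intro integral_diff[symmetric] intb) auto
      also have "norm \<dots> \<le> e / (8 * T) * (T - (-T))"
      proof (rule integral_bound)
        fix t assume t: "t \<in> {-T..T}"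
        have "Complex a (-t) - Complex 1 (-t) = of_real (a - 1)" by (simp add: complex_eq_iff)
        then have "dist (Complex a (-t)) (Complex 1 (-t)) = \<bar>a - 1\<bar>" by (simp only: dist_norm norm_of_real)
        then have "norm (zeta_difference (Complex a (-t)) - zeta_difference (Complex 1 (-t))) < e / (8 * T)"
          using d(2)[of "Complex 1 (-t)" "Complex a (-t)"] t elim by (auto simp: dist_norm K_def in_cbox_complex_iff)
        moreover have "\<bar>fejer_hat T t\<bar> \<le> 1" using fejer_hat_bounds[OF T, of t] t by auto
        ultimately have "\<bar>fejer_hat T t\<bar> * norm (zeta_difference (Complex a (-t)) - zeta_difference (Complex 1 (-t))) \<le> 1 * (e / (8 * T))"
          by (intro mult_mono) auto
        then show "norm (of_real (fejer_hat T t) * cis (- t * Y) * zeta_difference (Complex a (-t))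
           - of_real (fejer_hat T t) * cis (- t * Y) * zeta_difference (Complex 1 (-t))) \<le> e / (8 * T)"
          by (simp add: right_diff_distrib[symmetric] norm_mult)
      next
        show "continuous_on {- T..T} (\<lambda>t. of_real (fejer_hat T t) * cis (- t * Y) * zeta_difference (Complex a (-t))
           - of_real (fejer_hat T t) * cis (- t * Y) * zeta_difference (Complex 1 (-t)))"
          using elim by (intro continuous_intros contG continuous_on_fejer_hat) auto
      qed (use T in auto)
      also have "\<dots> = e / 4" using T by simp
      finally have "norm (J a Y - J 1 Y) \<le> e / 4" .
      then have less: "norm (J a Y) < e"
        using \<open>norm (J 1 Y) < e / 2\<close> norm_triangle_ineq2[of "J a Y" "J 1 Y"] e by linarith
      have "(\<lambda>n. of_real ((mangoldt n - 1) * real n powr (-a) * fejer T (ln (real n) - Y))) sums J a Y"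
        unfolding J_def using elim T by (intro fejer_sum_eq_integral) auto
      from sums_Re[OF this]
      have "(\<lambda>n. (mangoldt n - 1) * real n powr (-a) * fejer T (ln (real n) - Y)) sums Re (J a Y)"
        by (simp only: Re_complex_of_real)
      then have "(\<Sum>n. (mangoldt n - 1) * real n powr (-a) * fejer T (ln (real n) - Y)) = Re (J a Y)"
        by (simp add: sums_iff)
      then show ?case using less abs_Re_le_cmod[of "J a Y"] by linarith
    qed
  qed
qed

section \<open>The tail of the kernel sum\<close>

text \<open>Each side of \<open>J\<close> is dominated by a partial sum of the one-sided series, so
  the bound is uniform in \<open>J\<close> and \<open>M\<close>.\<close>

lemma sum_inverse_one_plus_square_le:
  "(\<Sum>j<M. 1 / (1 + (real j - real J)\<^sup>2)) \<le> 2 * (\<Sum>m. 1 / (1 + (real m)\<^sup>2))"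
proof -
  let ?g = "\<lambda>m::nat. 1 / (1 + (real m)\<^sup>2)"
  have sg: "summable ?g"
  proof (rule summable_comparison_test[OF exI, of 1])
    show "summable (\<lambda>m. 1 / real m ^ 2)" using inverse_power_summable[of 2, where ?'a=real] by (simp add: inverse_eq_divide)
    show "\<forall>n\<ge>1. norm (?g n) \<le> 1 / real n ^ 2" by (auto intro!: divide_left_mono mult_pos_pos add_pos_nonneg)
  qed
  have le: "sum ?g A \<le> (\<Sum>m. ?g m)" if "finite A" for A
    using that by (intro sum_le_suminf sg) auto
  have "(\<Sum>j<M. 1 / (1 + (real j - real J)\<^sup>2)) \<le> (\<Sum>j\<in>{..J} \<union> {J..J+M}. 1 / (1 + (real j - real J)\<^sup>2))"
    by (intro sum_mono2) auto
  also have "\<dots> \<le> (\<Sum>j\<in>{..J}. 1 / (1 + (real j - real J)\<^sup>2)) + (\<Sum>j\<in>{J..J+M}. 1 / (1 + (real j - real J)\<^sup>2))"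
    by (subst sum.union_inter[symmetric]) (auto intro!: sum_nonneg)
  also have "(\<Sum>j\<in>{..J}. 1 / (1 + (real j - real J)\<^sup>2)) = (\<Sum>m\<in>{..J}. ?g m)"
    by (rule sum.reindex_bij_witness[of _ "\<lambda>m. J - m" "\<lambda>j. J - j"]) (auto simp: of_nat_diff power2_commute)
  also have "(\<Sum>j\<in>{J..J+M}. 1 / (1 + (real j - real J)\<^sup>2)) = (\<Sum>m\<in>{..M}. ?g m)"
    by (rule sum.reindex_bij_witness[of _ "\<lambda>m. J + m" "\<lambda>j. j - J"]) (auto simp: of_nat_diff)
  also have "(\<Sum>m\<in>{..J}. ?g m) + (\<Sum>m\<in>{..M}. ?g m) \<le> (\<Sum>m. ?g m) + (\<Sum>m. ?g m)"
    by (intro add_mono le) auto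
  finally show ?thesis by simp
qed

lemma sum_mangoldt_over_dyadic_le:
  "(\<Sum>d\<in>{2^j<..2^Suc j}. mangoldt d / real d) \<le> ln 4"
proof -
  have "(\<Sum>d\<in>{2^j<..2^Suc j}. mangoldt d / real d) \<le> (\<Sum>d\<in>{2^j<..2*2^j}. mangoldt d / real (2^j))"
    by (auto intro!: sum_mono divide_left_mono mult_pos_pos mangoldt_nonneg intro: less_imp_le)
  also have "\<dots> = (\<Sum>d\<in>{2^j<..2*2^j}. mangoldt d) / real (2^j)"
    by (simp only: sum_divide_distrib)
  also have "\<dots> \<le> real (2^j) * ln 4 / real (2^j)"
    by (intro divide_right_mono sum_mangoldt_dyadic_le) auto
  finally show ?thesis by simp
qed

lemma sum_dyadic_decomposition:
  fixes f :: "nat \<Rightarrow> real"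
  shows "(\<Sum>d\<in>{1<..2^M}. f d) = (\<Sum>j<M. \<Sum>d\<in>{2^j<..2^Suc j}. f d)"
proof (induction M)
  case (Suc M)
  have "{1<..2^Suc M} = {1<..2^M} \<union> {2^M<..(2::nat)^Suc M}"
  proof -
    have "(1::nat) \<le> 2^M" "(2::nat)^M \<le> 2^Suc M" by auto
    then show ?thesis by (rule ivl_disj_un_two(6)[symmetric])
  qed
  then have "(\<Sum>d\<in>{1<..2^Suc M}. f d) = (\<Sum>d\<in>{1<..2^M}. f d) + (\<Sum>d\<in>{2^M<..2^Suc M}. f d)"
    by (simp del: power_Suc) (rule sum.union_disjoint, auto)
  with Suc show ?case by simp
qed auto

lemma ln2_ge_half: "ln (2::real) \<ge> 1/2"
  using ln_le_minus_one[of "1/2::real"] by (simp add: ln_div)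

text \<open>A dyadic block carries weight at most \<open>ln 4\<close>. In block \<open>j\<close> the
  distance \<open>|ln d - Y|\<close> is comparable to \<open>|j - J|\<close> when that is at least
  2, and at least \<open>\<eta>\<close> otherwise, so the blocks are dominated by a convergent
  series whose sum depends on neither \<open>Y\<close> nor \<open>N\<close>.\<close>

lemma sum_mangoldt_inverse_square_tail:
  assumes eta: "\<eta> > 0"
  obtains C :: real where "C > 0"
    "\<And>Y N. Y \<ge> 0 \<Longrightarrow> (\<Sum>d<N. if \<bar>ln (real d) - Y\<bar> \<ge> \<eta> then mangoldt d / real d / (ln (real d) - Y)\<^sup>2 else 0) \<le> C"
proof -
  \<comment> \<open>The 32 serves the blocks with \<open>|j - J| \<ge> 2\<close>; the other term
    serves the at most three blocks next to \<open>J\<close>.\<close>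
  define D where "D = 32 + 2 / \<eta>\<^sup>2"
  have D: "D > 0" using eta by (simp add: D_def add_pos_pos)
  define S where "S = (\<Sum>m. 1 / (1 + (real m)\<^sup>2))"
  have "(\<Sum>d<N. if \<bar>ln (real d) - Y\<bar> \<ge> \<eta> then mangoldt d / real d / (ln (real d) - Y)\<^sup>2 else 0) \<le> ln 4 * D * (2 * S)"
    if Y: "Y \<ge> 0" for Y N
  proof -
    let ?f = "\<lambda>d. if \<bar>ln (real d) - Y\<bar> \<ge> \<eta> then mangoldt d / real d / (ln (real d) - Y)\<^sup>2 else 0"
    define J where "J = nat \<lfloor>Y / ln 2\<rfloor>"
    have J0: "real J = real_of_int \<lfloor>Y / ln 2\<rfloor>" using Y by (simp add: J_def)
    have "real J \<le> Y / ln 2" "Y / ln 2 < real J + 1" unfolding J0 by linarith+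
    then have J: "real J * ln 2 \<le> Y" "Y < (real J + 1) * ln 2"
      by (simp_all add: field_simps)
    have f0: "?f d \<ge> 0" for d by (auto simp: mangoldt_nonneg)
    have "sum ?f {..<N} = sum ?f {1<..<N}"
      by (rule sum.mono_neutral_right) (auto simp: not_less le_Suc_eq)
    also have "\<dots> \<le> sum ?f {1<..2^N}"
    proof -
      have "N \<le> 2 ^ N" by (rule less_imp_le[OF less_exp])
      then have "{1<..<N} \<subseteq> {1<..2^N}" 
        by (meson greaterThanAtMost_iff greaterThanLessThan_iff less_imp_le less_le_trans subsetI)
      then show ?thesis by (intro sum_mono2 f0) auto
    qed
    also have "\<dots> = (\<Sum>j<N. sum ?f {2^j<..2^Suc j})"
      by (rule sum_dyadic_decomposition)
    also have "\<dots> \<le> (\<Sum>j<N. ln 4 * D * (1 / (1 + (real j - real J)\<^sup>2)))"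
    proof (rule sum_mono)
      fix j
      have "sum ?f {2^j<..2^Suc j} \<le> (\<Sum>d\<in>{2^j<..2^Suc j}. mangoldt d / real d * (D / (1 + (real j - real J)\<^sup>2)))"
      proof (rule sum_mono)
        fix d assume d: "d \<in> {2^j<..(2::nat)^Suc j}"
        define y where "y = ln (real d) - Y"
        have m0: "mangoldt d / real d \<ge> 0" by (simp add: mangoldt_nonneg)
        show "?f d \<le> mangoldt d / real d * (D / (1 + (real j - real J)\<^sup>2))"
        proof (cases "\<bar>y\<bar> \<ge> \<eta>")
          case False
          then show ?thesis using m0 D by (auto simp: y_def intro!: mult_nonneg_nonneg divide_nonneg_nonneg mangoldt_nonneg)
        next
          case True
          have dpos: "real d > 0" using d by auto
          have "real (2^j) < real d" "real d \<le> real (2^Suc j)" using d by (simp_all del: power_Suc of_nat_power)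
          then have "ln (real (2^j)) \<le> ln (real d)" "ln (real d) \<le> ln (real (2^Suc j))"
            using dpos by (auto simp del: power_Suc of_nat_power)
          then have lnd: "real j * ln 2 \<le> ln (real d)" "ln (real d) \<le> (real j + 1) * ln 2"
            by (simp_all add: ln_realpow ln_mult algebra_simps)
          define u where "u = real j - real J"
          have yl: "y \<ge> (u - 1) * ln 2" and yu: "y \<le> (u + 1) * ln 2"
            using lnd J by (simp_all add: y_def u_def algebra_simps)
          have "(1 + u\<^sup>2) \<le> D * y\<^sup>2"
          proof (cases "\<bar>u\<bar> \<ge> 2")
            case True
            have "\<bar>u\<bar> / 4 \<le> \<bar>y\<bar>"
            proof (cases "u \<ge> 0")
              case True
              with \<open>\<bar>u\<bar> \<ge> 2\<close> have u: "u \<ge> 2" by simp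
              then have "(u - 1) * (1/2) \<le> (u - 1) * ln 2" using ln2_ge_half by (intro mult_left_mono) auto
              then have "u / 4 \<le> y" using yl u by argo
              then show ?thesis using u by simp
            next
              case False
              with \<open>\<bar>u\<bar> \<ge> 2\<close> have u: "u \<le> -2" by simp
              then have "(u + 1) * ln 2 \<le> (u + 1) * (1/2)" using ln2_ge_half by (intro mult_left_mono_neg) auto
              then have "y \<le> u / 4" using yu u by argo
              then show ?thesis using u by simp
            qed
            then have "(\<bar>u\<bar> / 4)\<^sup>2 \<le> \<bar>y\<bar>\<^sup>2" by (intro power_mono) auto
            then have 1: "u\<^sup>2 \<le> 16 * y\<^sup>2" by (simp add: power_divide)
            have "2\<^sup>2 \<le> \<bar>u\<bar>\<^sup>2" using True by (intro power_mono) auto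
            then have "1 + u\<^sup>2 \<le> 32 * y\<^sup>2" using 1 by simp
            also have "\<dots> \<le> D * y\<^sup>2" by (intro mult_right_mono) (auto simp: D_def)
            finally show ?thesis .
          next
            case False
            \<comment> \<open>Integrality of \<open>j - J\<close> improves \<open>|u| < 2\<close> to
              \<open>|u| \<le> 1\<close>.\<close>
            have "real_of_int \<bar>int j - int J\<bar> < real_of_int 2" using False by (simp add: u_def)
            then have "\<bar>int j - int J\<bar> < 2" by (simp only: of_int_less_iff)
            then have "real_of_int \<bar>int j - int J\<bar> \<le> real_of_int 1" by (simp only: of_int_le_iff)
            then have "\<bar>u\<bar> \<le> 1" by (simp add: u_def)
            then have "u\<^sup>2 \<le> 1" by (simp add: abs_square_le_1)
            then have "1 + u\<^sup>2 \<le> 2" by simp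
            also have "\<dots> \<le> 2 / \<eta>\<^sup>2 * y\<^sup>2"
            proof -
              have "\<eta>\<^sup>2 \<le> \<bar>y\<bar>\<^sup>2" using \<open>\<bar>y\<bar> \<ge> \<eta>\<close> eta by (intro power_mono) auto
              then show ?thesis using eta by (simp add: field_simps)
            qed
            also have "\<dots> \<le> D * y\<^sup>2" by (intro mult_right_mono) (auto simp: D_def)
            finally show ?thesis .
          qed
          moreover have "y\<^sup>2 > 0" using True eta by auto
          moreover have "1 + u\<^sup>2 > 0" by (intro add_pos_nonneg) auto
          ultimately have "1 / y\<^sup>2 \<le> D / (1 + u\<^sup>2)" by (simp add: field_simps)
          then have "mangoldt d / real d * (1 / y\<^sup>2) \<le> mangoldt d / real d * (D / (1 + u\<^sup>2))"
            by (rule mult_left_mono[OF _ m0])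
          then show ?thesis using True by (simp add: y_def u_def)
        qed
      qed
      also have "\<dots> = (\<Sum>d\<in>{2^j<..2^Suc j}. mangoldt d / real d) * (D / (1 + (real j - real J)\<^sup>2))"
        by (simp only: sum_distrib_right)
      also have "\<dots> \<le> ln 4 * (D / (1 + (real j - real J)\<^sup>2))"
        using D by (intro mult_right_mono sum_mangoldt_over_dyadic_le divide_nonneg_nonneg) auto
      finally show "sum ?f {2^j<..2^Suc j} \<le> ln 4 * D * (1 / (1 + (real j - real J)\<^sup>2))" by simp
    qed
    also have "\<dots> = ln 4 * D * (\<Sum>j<N. 1 / (1 + (real j - real J)\<^sup>2))"
      by (simp only: sum_distrib_left)
    also have "\<dots> \<le> ln 4 * D * (2 * S)"
      unfolding S_def using D by (intro mult_left_mono sum_inverse_one_plus_square_le) auto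
    finally show ?thesis .
  qed
  note bound = this
  show ?thesis
  proof (rule that[of "\<bar>ln 4 * D * (2 * S)\<bar> + 1"])
    fix Y :: real and N assume "Y \<ge> 0"
    from bound[OF this, of N]
    show "(\<Sum>d<N. if \<bar>ln (real d) - Y\<bar> \<ge> \<eta> then mangoldt d / real d / (ln (real d) - Y)\<^sup>2 else 0) \<le> \<bar>ln 4 * D * (2 * S)\<bar> + 1"
      by linarith
  qed auto
qed

section \<open>The comparison sum over all integers\<close>

lemma summable_powr_fejer:
  assumes "a > 1" "T > 0"
  shows "summable (\<lambda>n. real n powr (-a) * fejer T (ln (real n) - Y))"
proof (rule summable_comparison_test[OF exI, of 0])
  show "summable (\<lambda>n. real n powr (-a) * T)"
    using assms by (intro summable_mult2) (simp add: summable_real_powr_iff)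
  show "\<forall>n\<ge>0. norm (real n powr (-a) * fejer T (ln (real n) - Y)) \<le> real n powr (-a) * T"
    using assms fejer_nonneg[of T] fejer_le[of T] by (auto simp: abs_mult intro!: mult_left_mono)
qed

text \<open>With \<open>u = exp Y\<close>, the integers from \<open>u\<close> to
  \<open>u + u / T\<close> number at least \<open>u / (2 * T)\<close>, because
  \<open>u \<ge> 2 * T\<close>. For each the kernel is at least \<open>T / 2\<close> and the power
  at least \<open>exp (- Y) / 6\<close>; the product of the three bounds is 1/24.\<close>

lemma fejer_sum_ge:
  assumes T: "T \<ge> 1" and Y: "exp Y \<ge> 2 * T"
  shows "\<forall>\<^sub>F a in at_right 1. (\<Sum>n. real n powr (-a) * fejer T (ln (real n) - Y)) \<ge> 1 / 24"
proof -
  have "exp Y > 1" using T Y by linarith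
  then have Y0: "Y > 0" by simp
  define u where "u = exp Y"
  define D where "D = {nat \<lceil>u\<rceil>..nat \<lfloor>u * (1 + 1 / T)\<rfloor>}"
  have u: "u \<ge> 2 * T" "u > 0" using Y by (auto simp: u_def)
  have uT: "u * (1 + 1 / T) = u + u / T" by (simp add: algebra_simps)
  have c: "real (card D) \<ge> u / (2 * T)"
  proof -
    have "u / T \<ge> 2" using u T by (simp add: field_simps)
    then have "u / T - 1 \<ge> u / T / 2" by argo
    moreover have "real (card D) \<ge> u / T - 1"
      unfolding D_def uT using u T \<open>u / T \<ge> 2\<close> by (simp add: of_nat_diff Suc_diff_le) linarith
    ultimately show ?thesis by (simp add: field_simps)
  qed
  \<comment> \<open>For such \<open>a\<close> and \<open>d \<le> exp (Y + 1)\<close>, the excess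
    power \<open>d powr (a - 1)\<close> is at most 2.\<close>
  have "\<forall>\<^sub>F a in at_right (1::real). a \<in> {1<..<1 + ln 2 / (Y + 1)}"
    using Y0 by (intro eventually_at_rightI[of 1 "1 + ln 2 / (Y + 1)"]) auto
  then show ?thesis
  proof eventually_elim
    case (elim a)
    then have a: "a > 1" "(a - 1) * (Y + 1) \<le> ln 2"
      using Y0 by (auto simp: field_simps)
    have each: "real d powr (-a) * fejer T (ln (real d) - Y) \<ge> exp (- Y) / 6 * (T / 2)" if d: "d \<in> D" for d
    proof -
      have "u \<le> real d" "real d \<le> u * (1 + 1 / T)"
        using d u T unfolding D_def by (auto simp: nat_le_iff le_nat_iff) linarith+
      then have d1: "u \<le> real d" "real d \<le> u * (1 + 1 / T)" "real d > 0" using u by auto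
      have "ln u \<le> ln (real d)" using d1 u by simp
      then have l1: "Y \<le> ln (real d)" by (simp add: u_def)
      have "ln (real d) \<le> ln (u * (1 + 1 / T))" using d1 u T by (simp add: add_pos_nonneg)
      also have "\<dots> = Y + ln (1 + 1 / T)" 
        using ln_mult_pos[of u "1 + 1 / T"] T u by (simp add: u_def add_pos_nonneg)
      also have "ln (1 + 1 / T) \<le> 1 / T" using T by (intro ln_add_one_self_le_self) auto
      finally have l2: "ln (real d) \<le> Y + 1 / T" by simp
      have "1 / T \<le> 1" using T by simp
      have F: "fejer T (ln (real d) - Y) \<ge> T / 2" using l1 l2 T by (intro fejer_ge) auto
      have "a * ln (real d) = (a - 1) * ln (real d) + ln (real d)" by (simp add: algebra_simps)
      also have "\<dots> \<le> (a - 1) * (Y + 1) + (Y + 1)"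
        using a l2 \<open>1 / T \<le> 1\<close> by (intro add_mono mult_left_mono) auto
      also have "\<dots> \<le> ln 2 + Y + 1" using a by simp
      finally have "exp (- (ln 2 + Y + 1)) \<le> exp (- a * ln (real d))" by simp
      also have "exp (- a * ln (real d)) = real d powr (-a)" using d1 by (simp add: powr_def)
      also have "exp (- (ln 2 + Y + 1)) = exp (- Y) / (2 * exp 1)"
        by (simp add: exp_add exp_minus exp_diff field_simps)
      finally have p: "exp (- Y) / (2 * exp 1) \<le> real d powr (-a)" .
      have "exp (- Y) / 6 \<le> exp (- Y) / (2 * exp 1)"
        using exp_le by (intro divide_left_mono) auto
      with p have "exp (- Y) / 6 \<le> real d powr (-a)" by linarith
      then show ?thesis using F T by (intro mult_mono) auto
    qed
    have "1 / 24 = u / (2 * T) * (exp (- Y) / 6 * (T / 2))"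
      using T by (simp add: u_def exp_minus field_simps)
    also have "\<dots> \<le> real (card D) * (exp (- Y) / 6 * (T / 2))"
      using c T by (intro mult_right_mono) auto
    also have "\<dots> \<le> (\<Sum>d\<in>D. real d powr (-a) * fejer T (ln (real d) - Y))"
      using sum_mono[of D "\<lambda>_. exp (- Y) / 6 * (T / 2)"] each by simp
    also have "\<dots> \<le> (\<Sum>n. real n powr (-a) * fejer T (ln (real n) - Y))"
    proof (rule sum_le_suminf)
      show "summable (\<lambda>n. real n powr (-a) * fejer T (ln (real n) - Y))"
        using a T by (intro summable_powr_fejer) auto
    qed (use T fejer_nonneg[of T] in \<open>auto simp: D_def\<close>)
    finally show ?case .
  qed
qed

section \<open>Primes in short intervals\<close>

text \<open>An instance of \<open>psi_smooth_le\<close> with \<open>r = 1\<close>: squares and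
  higher powers up to \<open>n\<close> have base at most the square root of
  \<open>n\<close>.\<close>

lemma psi_smooth_sqrt_le:
  assumes "n > 0"
  shows "psi_smooth (nat \<lfloor>sqrt (real n)\<rfloor>) n \<le> 4 * (1 + log 2 (real n)) * sqrt (real n)"
proof -
  define q where "q = nat \<lfloor>sqrt (real n)\<rfloor>"
  have q: "real q \<le> sqrt (real n)" by (simp add: q_def)
  have small: "p \<le> q" if "p ^ Suc 1 \<le> n" for p
  proof -
    have "real (p ^ 2) \<le> real n" using that by (intro of_nat_mono) (simp add: numeral_2_eq_2)
    then have "real p \<le> sqrt (real n)" by (intro real_le_rsqrt) simp
    then show ?thesis by (simp add: q_def le_nat_floor)
  qed
  obtain L where L: "2 ^ L \<le> n" "n < 2 ^ Suc L"
    using ex_power_ivl1[of 2 n] assms by auto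
  have "psi_smooth q n \<le> real 1 * psi q + real L * psi q"
    by (rule psi_smooth_le[OF small L(2)])
  also have "\<dots> = (1 + real L) * psi q" by (simp add: algebra_simps)
  also have "\<dots> \<le> (1 + log 2 (real n)) * (4 * sqrt (real n))"
    using le_log2_of_power[OF L(1)] psi_le[of q] q psi_nonneg[of q] assms by (intro mult_mono) auto
  finally show ?thesis by (simp add: q_def algebra_simps)
qed

text \<open>Without primes, the window holds only prime powers of exponent at least 2. Their bases
  are at most the square root of \<open>n\<close>, so their weight is negligible against
  \<open>n\<close>.\<close>

lemma sum_mangoldt_window_le:
  assumes \<delta>: "0 < \<delta>" "\<delta> < 1" and n: "n > 0"
    and no_prime: "\<And>p. prime p \<Longrightarrow> (1 - \<delta>) * real n < real p \<Longrightarrow> p \<le> n \<Longrightarrow> False"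
    and A: "finite A" "\<And>d. d \<in> A \<Longrightarrow> (1 - \<delta>) * real n < real d \<and> d \<le> n"
  shows "(\<Sum>d\<in>A. mangoldt d / real d) \<le> 4 / (1 - \<delta>) * ((1 + log 2 (real n)) * sqrt (real n) / real n)"
proof -
  define q where "q = nat \<lfloor>sqrt (real n)\<rfloor>"
  define B where "B = {d. d \<in> {1..n} \<and> primepow d \<and> aprimedivisor d \<le> q}"
  have pos: "(1 - \<delta>) * real n > 0" using \<delta> n by simp
  have sub: "{d\<in>A. primepow d} \<subseteq> B"
  proof safe
    fix d assume d: "d \<in> A" "primepow d"
    define p where "p = aprimedivisor d"
    obtain i where p: "prime p" "i > 0" "d = p ^ i"
      using primepow_aprimedivisorD[OF d(2)] unfolding p_def by blast
    have dn: "(1 - \<delta>) * real n < real d" "d \<le> n" using A(2) d by auto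
    then have "\<not> prime d" using no_prime by blast
    with p have "i \<noteq> 1" by auto
    with p have "2 \<le> i" by auto
    then have "p ^ 2 \<le> d" unfolding p(3) using p prime_ge_1_nat[of p] by (intro power_increasing) auto
    then have "p ^ 2 \<le> n" using dn by simp
    then have "real (p ^ 2) \<le> real n" by (intro of_nat_mono)
    then have "real p \<le> sqrt (real n)" by (intro real_le_rsqrt) simp
    then have "p \<le> q" by (simp add: q_def le_nat_floor)
    then show "d \<in> B" using d dn primepow_gt_0_nat[of d] by (auto simp: B_def p_def)
  qed
  have "(\<Sum>d\<in>A. mangoldt d / real d) = (\<Sum>d\<in>{d\<in>A. primepow d}. mangoldt d / real d)"
    using A by (intro sum.mono_neutral_right) (auto simp: mangoldt_def)
  also have "\<dots> \<le> (\<Sum>d\<in>{d\<in>A. primepow d}. mangoldt d / ((1 - \<delta>) * real n))"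
    using A(2) pos less_trans[OF pos] \<delta> n primepow_gt_0_nat
    by (intro sum_mono divide_left_mono mult_pos_pos mangoldt_nonneg) (auto intro: less_imp_le)
  also have "\<dots> \<le> (\<Sum>d\<in>B. mangoldt d / ((1 - \<delta>) * real n))"
    using \<delta> by (intro sum_mono2 sub) (auto simp: B_def mangoldt_nonneg)
  also have "\<dots> = psi_smooth q n / ((1 - \<delta>) * real n)"
    by (simp add: sum_divide_distrib psi_smooth_def B_def)
  also have "\<dots> \<le> 4 * (1 + log 2 (real n)) * sqrt (real n) / ((1 - \<delta>) * real n)"
    unfolding q_def using pos by (intro divide_right_mono psi_smooth_sqrt_le n) auto
  finally show ?thesis by (simp add: field_simps)
qed

text \<open>Inside the logarithmic window the kernel is at most \<open>T\<close>, outside it at most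
  \<open>4 / (T * y\<^sup>2)\<close>. As \<open>B\<close> and \<open>C\<close> are independent of
  \<open>T\<close>, a large \<open>T\<close> suppresses the tail, and a small \<open>B\<close> then
  suppresses the window.\<close>

lemma fejer_mangoldt_sum_le:
  assumes a: "a > 1" and T: "T > 0" and eta: "\<eta> > 0"
    and win: "\<And>N. (\<Sum>d<N. if \<bar>ln (real d) - Y\<bar> < \<eta> then mangoldt d / real d else 0) \<le> B"
    and tail: "\<And>N. (\<Sum>d<N. if \<bar>ln (real d) - Y\<bar> \<ge> \<eta> then mangoldt d / real d / (ln (real d) - Y)\<^sup>2 else 0) \<le> C"
  shows "summable (\<lambda>n. mangoldt n * real n powr (-a) * fejer T (ln (real n) - Y))"
    "(\<Sum>n. mangoldt n * real n powr (-a) * fejer T (ln (real n) - Y)) \<le> T * B + 4 / T * C"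
proof -
  let ?f = "\<lambda>n. mangoldt n * real n powr (-a) * fejer T (ln (real n) - Y)"
  show sf: "summable ?f"
  proof (rule summable_comparison_test[OF exI, of 0])
    show "summable (\<lambda>n. mangoldt n * real n powr (-a) * T)"
      using a by (intro summable_mult2 summable_mangoldt_powr)
    show "\<forall>n\<ge>0. norm (?f n) \<le> mangoldt n * real n powr (-a) * T"
      using T fejer_nonneg[of T] fejer_le[of T] 
      by (auto simp: abs_mult mangoldt_nonneg intro!: mult_left_mono mult_nonneg_nonneg)
  qed
  show "suminf ?f \<le> T * B + 4 / T * C"
  proof (rule suminf_le_const[OF sf])
    fix N
    have "sum ?f {..<N} \<le> (\<Sum>d<N. T * (if \<bar>ln (real d) - Y\<bar> < \<eta> then mangoldt d / real d else 0)
        + 4 / T * (if \<bar>ln (real d) - Y\<bar> \<ge> \<eta> then mangoldt d / real d / (ln (real d) - Y)\<^sup>2 else 0))"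
    proof (rule sum_mono)
      fix d
      define y where "y = ln (real d) - Y"
      have F: "fejer T y \<ge> 0" using T by (rule fejer_nonneg)
      have le: "mangoldt d * real d powr (-a) \<le> mangoldt d / real d"
      proof (cases "d = 0")
        case False
        then have "real d powr (-a) \<le> real d powr (-1)" using a by (intro powr_mono) auto
        then have "mangoldt d * real d powr (-a) \<le> mangoldt d * real d powr (-1)"
          by (intro mult_left_mono mangoldt_nonneg)
        then show ?thesis using False by (simp add: powr_minus field_simps)
      qed auto
      have m0: "mangoldt d / real d \<ge> 0" by (simp add: mangoldt_nonneg)
      have f1: "?f d \<le> mangoldt d / real d * fejer T y"
        unfolding y_def[symmetric] by (intro mult_right_mono le F)
      show "?f d \<le> T * (if \<bar>ln (real d) - Y\<bar> < \<eta> then mangoldt d / real d else 0)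
        + 4 / T * (if \<bar>ln (real d) - Y\<bar> \<ge> \<eta> then mangoldt d / real d / (ln (real d) - Y)\<^sup>2 else 0)"
      proof (cases "\<bar>y\<bar> < \<eta>")
        case True
        have "mangoldt d / real d * fejer T y \<le> mangoldt d / real d * T"
          by (intro mult_left_mono m0 fejer_le T)
        then show ?thesis using True f1 by (simp add: y_def mult.commute)
      next
        case False
        then have "y \<noteq> 0" using eta by auto
        have "mangoldt d / real d * fejer T y \<le> mangoldt d / real d * (4 / (T * y\<^sup>2))"
          by (intro mult_left_mono m0 fejer_le_inverse_square T \<open>y \<noteq> 0\<close>)
        also have "\<dots> = 4 / T * (mangoldt d / real d / y\<^sup>2)" by (simp add: mult_ac)
        finally show ?thesis using False f1 by (simp add: y_def)
      qed
    qed
    also have "\<dots> = T * (\<Sum>d<N. if \<bar>ln (real d) - Y\<bar> < \<eta> then mangoldt d / real d else 0)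
       + 4 / T * (\<Sum>d<N. if \<bar>ln (real d) - Y\<bar> \<ge> \<eta> then mangoldt d / real d / (ln (real d) - Y)\<^sup>2 else 0)"
      by (simp only: sum.distrib sum_distrib_left)
    also have "\<dots> \<le> T * B + 4 / T * C"
      using T by (intro add_mono mult_left_mono win tail) auto
    finally show "sum ?f {..<N} \<le> T * B + 4 / T * C" .
  qed
qed

text \<open>Without primes in the interval, the kernel sum weighted by \<open>mangoldt\<close> is
  below 2/96: one share for the window and one for the tail. It differs by less than 1/96 from the
  sum with weight 1, which is at least 1/24.\<close>

lemma eventually_prime_in_short_interval:
  fixes \<delta> :: real
  assumes \<delta>: "0 < \<delta>" "\<delta> < 1"
  shows "\<forall>\<^sub>F n in sequentially. \<exists>p. prime p \<and> (1 - \<delta>) * real n < real p \<and> p \<le> n"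
proof -
  \<comment> \<open>The logarithmic window of half-width \<open>\<eta>\<close> about
    \<open>ln n - \<eta>\<close> ends at \<open>ln n\<close> and starts at
    \<open>ln n + ln (1 - \<delta>) / 2\<close>, safely inside the interval considered.\<close>
  define \<eta> where "\<eta> = - ln (1 - \<delta>) / 4"
  have ln\<delta>: "ln (1 - \<delta>) < 0" using \<delta> by simp
  then have eta: "\<eta> > 0" by (simp add: \<eta>_def)
  obtain C where C: "C > 0" and tail:
    "\<And>Y N. Y \<ge> 0 \<Longrightarrow> (\<Sum>d<N. if \<bar>ln (real d) - Y\<bar> \<ge> \<eta> then mangoldt d / real d / (ln (real d) - Y)\<^sup>2 else 0) \<le> C"
    by (rule sum_mangoldt_inverse_square_tail[OF eta]) blast
  \<comment> \<open>Since 384 is 4 times 96, the tail contributes at most 1/96; \<open>C\<close>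
    depends only on \<open>\<eta>\<close>, so there is no circularity.\<close>
  define T where "T = max 1 (384 * C)"
  have T: "T \<ge> 1" "4 / T * C \<le> 1 / 96"
  proof -
    show "T \<ge> 1" by (simp add: T_def)
    have "384 * C \<le> T" by (simp add: T_def)
    then show "4 / T * C \<le> 1 / 96" using \<open>T \<ge> 1\<close> by (simp add: field_simps)
  qed
  have lim: "filterlim (\<lambda>n::nat. ln (real n) - \<eta>) at_top sequentially"
    by real_asymp
  define w where "w = (\<lambda>n::nat. 4 / (1 - \<delta>) * ((1 + log 2 (real n)) * sqrt (real n) / real n))"
  have "(\<lambda>n::nat. (1 + log 2 (real n)) * sqrt (real n) / real n) \<longlonglongrightarrow> 0"
    by real_asymp
  then have "(\<lambda>n. T * w n) \<longlonglongrightarrow> T * (4 / (1 - \<delta>) * 0)"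
    unfolding w_def by (intro tendsto_mult tendsto_const)
  then have "\<forall>\<^sub>F n in sequentially. T * w n < 1 / 96"
    by (rule order_tendstoD) simp
  moreover have "\<forall>\<^sub>F n in sequentially. \<forall>\<^sub>F a in at_right 1.
    \<bar>\<Sum>d. (mangoldt d - 1) * real d powr (-a) * fejer T (ln (real d) - (ln (real n) - \<eta>))\<bar> < 1 / 96"
    using T by (intro eventually_compose_filterlim[OF fejer_sum_small lim]) auto
  moreover have "\<forall>\<^sub>F n in sequentially. ln (real n) - \<eta> \<ge> ln (2 * T)"
    using lim by (auto simp: filterlim_at_top)
  moreover have "\<forall>\<^sub>F n in sequentially. ln (real n) - \<eta> \<ge> 0"
    using lim unfolding filterlim_at_top by blast
  ultimately show ?thesis
    using eventually_gt_at_top[of 0]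
  proof eventually_elim
    case (elim n)
    define Y where "Y = ln (real n) - \<eta>"
    show ?case
    proof (rule ccontr)
      assume "\<not> (\<exists>p. prime p \<and> (1 - \<delta>) * real n < real p \<and> p \<le> n)"
      then have no_prime: "\<And>p. prime p \<Longrightarrow> (1 - \<delta>) * real n < real p \<Longrightarrow> p \<le> n \<Longrightarrow> False"
        by blast
      have win: "(\<Sum>d<N. if \<bar>ln (real d) - Y\<bar> < \<eta> then mangoldt d / real d else 0) \<le> w n" for N
      proof -
        have "(\<Sum>d<N. if \<bar>ln (real d) - Y\<bar> < \<eta> then mangoldt d / real d else 0)
            = (\<Sum>d\<in>{d\<in>{..<N}. \<bar>ln (real d) - Y\<bar> < \<eta> \<and> d > 0}. mangoldt d / real d)"
          by (rule sum.mono_neutral_cong_right) auto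
        also have "\<dots> \<le> w n"
          unfolding w_def
        proof (rule sum_mangoldt_window_le[OF \<delta> _ no_prime])
          fix d assume "d \<in> {d\<in>{..<N}. \<bar>ln (real d) - Y\<bar> < \<eta> \<and> d > 0}"
          then have d: "d > 0" "ln (real d) < ln (real n)" "ln (real d) > ln (real n) - 2 * \<eta>"
            by (auto simp: Y_def abs_less_iff)
          then have "real d < real n" using elim by simp
          have "ln ((1 - \<delta>) * real n) = ln (1 - \<delta>) + ln (real n)" using \<delta> elim by (simp add: ln_mult)
          also have "\<dots> < ln (real d)" using d(3) ln\<delta> unfolding \<eta>_def by argo
          finally have "(1 - \<delta>) * real n < real d" using \<delta> elim d by simp
          with \<open>real d < real n\<close> show "(1 - \<delta>) * real n < real d \<and> d \<le> n" by simp
        qed (use elim in auto)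
        finally show ?thesis .
      qed
      have Y0: "Y \<ge> 0" using elim by (simp add: Y_def)
      have expY: "exp Y \<ge> 2 * T"
      proof -
        have "exp (ln (2 * T)) \<le> exp Y" using elim by (simp add: Y_def)
        then show ?thesis using T by simp
      qed
      have ev1: "\<forall>\<^sub>F a in at_right 1. \<bar>\<Sum>d. (mangoldt d - 1) * real d powr (-a) * fejer T (ln (real d) - Y)\<bar> < 1 / 96"
        using elim by (simp add: Y_def)
      have ev: "\<forall>\<^sub>F a in at_right (1::real). False"
        using ev1 fejer_sum_ge[OF T(1) expY] eventually_at_right_less[of "1::real"]
      proof eventually_elim
        case (elim a)
        have up: "summable (\<lambda>n. mangoldt n * real n powr (-a) * fejer T (ln (real n) - Y))"
          "(\<Sum>n. mangoldt n * real n powr (-a) * fejer T (ln (real n) - Y)) \<le> T * w n + 4 / T * C"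
          using fejer_mangoldt_sum_le[OF elim(3) _ eta win tail[OF Y0]] T(1) by auto
        have s2: "summable (\<lambda>n. real n powr (-a) * fejer T (ln (real n) - Y))"
          using elim(3) T(1) by (intro summable_powr_fejer) auto
        have "(\<Sum>d. (mangoldt d - 1) * real d powr (-a) * fejer T (ln (real d) - Y)) =
          (\<Sum>n. mangoldt n * real n powr (-a) * fejer T (ln (real n) - Y)) - (\<Sum>n. real n powr (-a) * fejer T (ln (real n) - Y))"
          by (subst suminf_diff[OF up(1) s2]) (simp add: algebra_simps)
        then show False using elim(1,2) up(2) T(2) \<open>T * w n < 1 / 96\<close> by linarith
      qed
      then show False by simp
    qed
  qed
qed

section \<open>Smooth numbers in short windows\<close>

text \<open>A weak form of Stirling's bound; the induction step rests on
  \<open>n * ln (1 + 1 / n) \<le> 1\<close>.\<close>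

lemma ln_fact_ge: "real n * ln (real n) - real n \<le> ln (fact n)"
proof (induction n)
  case (Suc n)
  show ?case
  proof (cases "n = 0")
    case False
    have "ln (real (Suc n)) - ln (real n) = ln (1 + 1 / real n)"
      using False ln_divide_pos[of "real (Suc n)" "real n"] by (simp add: add_divide_distrib add.commute)
    also have "\<dots> \<le> 1 / real n" by (rule ln_add_one_self_le_self) simp
    finally have "real n * (ln (real (Suc n)) - ln (real n)) \<le> real n * (1 / real n)"
      by (intro mult_left_mono) auto
    then have "real n * ln (real (Suc n)) \<le> real n * ln (real n) + 1"
      using False by (simp add: algebra_simps del: of_nat_Suc)
    moreover have "ln (fact (Suc n)) = ln (real (Suc n)) + ln (fact n :: real)"
      by (simp add: ln_mult del: of_nat_Suc)
    moreover have "real (Suc n) * ln (real (Suc n)) = real n * ln (real (Suc n)) + ln (real (Suc n))"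
      by (simp add: algebra_simps)
    ultimately show ?thesis using Suc by simp
  qed auto
qed auto

text \<open>Turns a real lower bound for \<open>A\<close> into one for \<open>A!\<close>, as
  \<open>x * (ln x - 1)\<close> increases once \<open>ln x \<ge> 1\<close>.\<close>

lemma ln_fact_ge_of_le:
  assumes "x > 0" "x \<le> real A" "ln x \<ge> 1"
  shows "x * (ln x - 1) \<le> ln (fact A)"
proof -
  have "x * (ln x - 1) \<le> real A * (ln (real A) - 1)"
    using assms by (intro mult_mono) auto
  also have "\<dots> \<le> ln (fact A)" using ln_fact_ge[of A] by (simp add: algebra_simps)
  finally show ?thesis .
qed

lemma ln_fact_le: "k > 0 \<Longrightarrow> ln (fact k) \<le> real k * ln (real k)"
proof -
  assume "k > 0"
  have "fact k \<le> real (k ^ k)" by (rule fact_le_power)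
  then have "ln (fact k) \<le> ln (real k ^ k)" using \<open>k > 0\<close> by simp
  then show ?thesis using \<open>k > 0\<close> by (simp add: ln_realpow)
qed

lemma sum_dvd_indicator:
  "(\<Sum>m\<in>{1..n}. if q dvd m then 1 else 0 :: real) = real (n div q)"
proof (induction n)
  case (Suc n)
  then show ?case by (simp add: div_Suc dvd_eq_mod_eq_0)
qed auto

lemma sum_dvd_indicator_window:
  assumes "k \<le> n" "q > 0"
  shows "(\<Sum>m\<in>{n-k<..n}. if q dvd m then 1 else 0 :: real) \<le> real (k div q) + 1"
proof -
  let ?f = "\<lambda>m. if q dvd m then 1 else 0 :: real"
  have "sum ?f {1..n} = sum ?f {1..n-k} + sum ?f {n-k<..n}"
    by (subst sum.union_disjoint[symmetric]) (auto intro!: sum.cong)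
  then have "sum ?f {n-k<..n} = real (n div q) - real ((n - k) div q)"
    by (simp add: sum_dvd_indicator del: One_nat_def)
  moreover have n: "n = k + (n - k)" using assms by simp
  have "n div q = k div q + (n - k) div q + (k mod q + (n - k) mod q) div q"
    by (subst n, rule div_add1_eq)
  moreover have "(k mod q + (n - k) mod q) div q < 2"
  proof (rule less_mult_imp_div_less)
    have "k mod q < q" "(n - k) mod q < q" using assms by auto
    then show "k mod q + (n - k) mod q < 2 * q" by linarith
  qed
  ultimately show ?thesis by linarith
qed

section \<open>The abc bound for radicals in a window\<close>

text \<open>For positive \<open>m\<close> with all prime factors at most \<open>A\<close> this is
  the logarithm of the radical. The common range \<open>{1..A}\<close> allows an exchange with the
  sum over the window.\<close>

definition ln_radical_upto :: "nat \<Rightarrow> nat \<Rightarrow> real" where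
  "ln_radical_upto A m = (\<Sum>q\<in>{1..A}. if prime q \<and> q dvd m then ln (real q) else 0)"

lemma ln_radical_upto_nonneg: "ln_radical_upto A m \<ge> 0"
  unfolding ln_radical_upto_def by (intro sum_nonneg) auto

text \<open>The radical of a product is at most the product of the radicals; the factor 1 keeps the
  shape \<open>a * b * c\<close> of the triple \<open>1 + (m - 1) = m\<close>.\<close>

lemma ln_rad_consecutive_le:
  assumes m: "m \<ge> 2" and small: "\<And>p. prime p \<Longrightarrow> p dvd m \<or> p dvd m - 1 \<Longrightarrow> p \<le> A"
  shows "ln (real_of_int (rad (1 * int (m - 1) * int m))) \<le> ln_radical_upto A (m - 1) + ln_radical_upto A m"
proof -
  define x where "x = 1 * int (m - 1) * int m"
  have x: "x \<noteq> 0" using m by (simp add: x_def)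
  have pf: "prime p \<and> p dvd x" if "p \<in> prime_factors x" for p
    using that by (auto simp: in_prime_factors_iff)
  define Q where "Q = {q\<in>{1..A}. prime q \<and> (q dvd m \<or> q dvd m - 1)}"
  have sub: "prime_factors x \<subseteq> int ` Q"
  proof
    fix p assume "p \<in> prime_factors x"
    then have p: "prime p" "p dvd x" using pf by auto
    define q where "q = nat p"
    have pq: "p = int q" using prime_ge_0_int[OF p(1)] by (simp add: q_def)
    have q: "prime q" using p(1) pq by simp
    have "int q dvd int ((m - 1) * m)" using p(2) unfolding pq x_def by simp
    then have "q dvd (m - 1) * m" by (simp only: int_dvd_int_iff)
    then have d: "q dvd m \<or> q dvd m - 1" using q by (auto simp: prime_dvd_mult_iff)
    then have "q \<in> Q" using small[OF q d] q prime_ge_1_nat[OF q] by (auto simp: Q_def)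
    then show "p \<in> int ` Q" using pq by blast
  qed
  have "ln (real_of_int (rad x)) = (\<Sum>p\<in>prime_factors x. ln (real_of_int p))"
    unfolding rad_def of_int_prod by (rule ln_prod) (auto dest: pf prime_gt_0_int)
  also have "\<dots> \<le> (\<Sum>p\<in>int ` Q. ln (real_of_int p))"
    by (intro sum_mono2 sub) (auto simp: Q_def)
  also have "\<dots> = (\<Sum>q\<in>Q. ln (real q))"
    by (subst sum.reindex) (auto simp: inj_on_def)
  also have "\<dots> = (\<Sum>q\<in>{1..A}. if prime q \<and> (q dvd m \<or> q dvd m - 1) then ln (real q) else 0)"
    unfolding Q_def by (rule sum.inter_filter) simp
  also have "\<dots> \<le> (\<Sum>q\<in>{1..A}. (if prime q \<and> q dvd m - 1 then ln (real q) else 0) + (if prime q \<and> q dvd m then ln (real q) else 0))"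
    by (intro sum_mono) auto
  also have "\<dots> = ln_radical_upto A (m - 1) + ln_radical_upto A m"
    unfolding ln_radical_upto_def by (rule sum.distrib)
  finally show ?thesis by (simp add: x_def)
qed

lemma explicit_abc_consecutive:
  assumes abc: "explicit_abc" and m: "m \<ge> 2"
    and small: "\<And>p. prime p \<Longrightarrow> p dvd m \<or> p dvd m - 1 \<Longrightarrow> p \<le> A"
  shows "4 / 7 * ln (real m) \<le> ln_radical_upto A (m - 1) + ln_radical_upto A m"
proof -
  have "coprime (int (m - 1)) (int m)"
    using m coprime_diff_one_left_nat[of m] by simp
  moreover have "1 + int (m - 1) = int m" using m by simp
  ultimately have less: "real_of_int (int m) < real_of_int (rad (1 * int (m - 1) * int m)) powr (7 / 4)"
    using abc m unfolding explicit_abc_def by (elim allE[of _ 1] allE[of _ "int (m - 1)"] allE[of _ "int m"]) auto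
  have "rad (1 * int (m - 1) * int m) > 0"
    unfolding rad_def by (intro prod_pos) (auto simp: in_prime_factors_iff dest: prime_gt_0_int)
  then have pos: "real_of_int (rad (1 * int (m - 1) * int m)) > 0" by simp
  have "ln (real m) < ln (real_of_int (rad (1 * int (m - 1) * int m)) powr (7 / 4))"
    using less m pos by (subst ln_less_cancel_iff) auto
  also have "\<dots> = 7 / 4 * ln (real_of_int (rad (1 * int (m - 1) * int m)))"
    using pos by (simp add: ln_powr)
  also have "\<dots> \<le> 7 / 4 * (ln_radical_upto A (m - 1) + ln_radical_upto A m)"
    by (intro mult_left_mono ln_rad_consecutive_le m small) auto
  finally show ?thesis by simp
qed

text \<open>A prime \<open>q \<le> A\<close> has at most \<open>k div q + 1\<close> multiples in the
  window. The summands 1 add up to at most \<open>psi A\<close>, the quotients to at most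
  \<open>ln (fact k)\<close> by Legendre's formula.\<close>

lemma sum_ln_radical_window_le:
  assumes "k \<le> n"
  shows "(\<Sum>m\<in>{n-k<..n}. ln_radical_upto A m) \<le> psi A + ln (fact k)"
proof -
  have "(\<Sum>m\<in>{n-k<..n}. ln_radical_upto A m) =
      (\<Sum>q\<in>{1..A}. \<Sum>m\<in>{n-k<..n}. if prime q \<and> q dvd m then ln (real q) else 0)"
    unfolding ln_radical_upto_def by (rule sum.swap)
  also have "\<dots> \<le> (\<Sum>q\<in>{1..A}. mangoldt q * (real (k div q) + 1))"
  proof (rule sum_mono)
    fix q assume q: "q \<in> {1..A}"
    show "(\<Sum>m\<in>{n-k<..n}. if prime q \<and> q dvd m then ln (real q) else 0) \<le> mangoldt q * (real (k div q) + 1)"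
    proof (cases "prime q")
      case True
      have "(\<Sum>m\<in>{n-k<..n}. if prime q \<and> q dvd m then ln (real q) else 0) =
         ln (real q) * (\<Sum>m\<in>{n-k<..n}. if q dvd m then 1 else 0)"
        unfolding sum_distrib_left using True by (intro sum.cong) auto
      also have "\<dots> \<le> ln (real q) * (real (k div q) + 1)"
        using q by (intro mult_left_mono sum_dvd_indicator_window assms) auto
      finally show ?thesis using True by simp
    qed (auto intro!: mult_nonneg_nonneg mangoldt_nonneg)
  qed
  also have "\<dots> = (\<Sum>q\<in>{1..A}. mangoldt q * real (k div q)) + psi A"
    by (simp add: psi_def sum.distrib[symmetric] algebra_simps)
  \<comment> \<open>Legendre's formula for \<open>k\<close> needs a range reaching \<open>k\<close>,
    which \<open>A\<close> might not.\<close>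
  also have "(\<Sum>q\<in>{1..A}. mangoldt q * real (k div q)) \<le> (\<Sum>q\<in>{1..max A k}. mangoldt q * real (k div q))"
    by (intro sum_mono2) (auto intro!: mult_nonneg_nonneg mangoldt_nonneg)
  also have "\<dots> = ln (fact k)" by (rule ln_fact_eq_sum_mangoldt[symmetric]) simp
  finally show ?thesis by simp
qed

text \<open>The abc bound is summed over the \<open>k - 1\<close> pairs of consecutive numbers in
  the window, all at least \<open>n / 2\<close>. Each number occurs in at most two pairs, whence the
  factor 2, and \<open>k - 1 \<ge> k / 2\<close> turns 4/7 into 2/7.\<close>

lemma explicit_abc_window:
  assumes abc: "explicit_abc" and k: "2 \<le> k" "2 * k \<le> n"
    and small: "\<And>m p. n - k < m \<Longrightarrow> m \<le> n \<Longrightarrow> prime p \<Longrightarrow> p dvd m \<Longrightarrow> p \<le> A"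
  shows "real k * (2 / 7) * ln (real n / 2) \<le> 2 * (psi A + ln (fact k))"
proof -
  let ?L = "ln_radical_upto A"
  have ln0: "ln (real n / 2) \<ge> 0" using k by simp
  have "real k * (2 / 7) * ln (real n / 2) \<le> real (k - 1) * (4 / 7 * ln (real n / 2))"
    using k ln0 by (auto simp: of_nat_diff intro!: mult_right_mono)
  also have "\<dots> = (\<Sum>m\<in>{n-k+1<..n}. 4 / 7 * ln (real n / 2))"
    using k by (simp add: of_nat_diff)
  also have "\<dots> \<le> (\<Sum>m\<in>{n-k+1<..n}. ?L (m - 1) + ?L m)"
  proof (rule sum_mono)
    fix m assume m: "m \<in> {n-k+1<..n}"
    have "real n \<le> real (2 * m)" using m k by (intro of_nat_mono) auto
    then have "4 / 7 * ln (real n / 2) \<le> 4 / 7 * ln (real m)" using m k by (intro mult_left_mono) auto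
    also have "\<dots> \<le> ?L (m - 1) + ?L m"
    proof (rule explicit_abc_consecutive[OF abc])
      show "2 \<le> m" using m by auto
      fix p assume "prime p" "p dvd m \<or> p dvd m - 1"
      then show "p \<le> A" using small[of m p] small[of "m - 1" p] m by fastforce
    qed
    finally show "4 / 7 * ln (real n / 2) \<le> ?L (m - 1) + ?L m" .
  qed
  also have "\<dots> = (\<Sum>m\<in>{n-k+1<..n}. ?L (m - 1)) + (\<Sum>m\<in>{n-k+1<..n}. ?L m)"
    by (rule sum.distrib)
  also have "(\<Sum>m\<in>{n-k+1<..n}. ?L (m - 1)) = (\<Sum>m\<in>{n-k<..n-1}. ?L m)"
    by (rule sum.reindex_bij_witness[of _ Suc "\<lambda>m. m - 1"]) auto
  also have "\<dots> \<le> (\<Sum>m\<in>{n-k<..n}. ?L m)"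
    by (intro sum_mono2) (auto simp: ln_radical_upto_nonneg)
  also have "(\<Sum>m\<in>{n-k+1<..n}. ?L m) \<le> (\<Sum>m\<in>{n-k<..n}. ?L m)"
    by (intro sum_mono2) (auto simp: ln_radical_upto_nonneg)
  finally have "real k * (2 / 7) * ln (real n / 2) \<le> 2 * (\<Sum>m\<in>{n-k<..n}. ?L m)" by simp
  also have "\<dots> \<le> 2 * (psi A + ln (fact k))"
    using k by (intro mult_left_mono sum_ln_radical_window_le) auto
  finally show ?thesis .
qed

section \<open>Short, medium and long windows\<close>

text \<open>The exponent 1/8 bounds \<open>2 * ln (fact k)\<close> by \<open>k * l / 4\<close>, less
  than the \<open>2 / 7 * k * l\<close> supplied by abc. The difference, 1/28, halved to absorb the
  constant 2/7 and divided by 8, gives \<open>A \<ge> k * l / 448\<close>, and Stirling gains a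
  further factor growing with \<open>n\<close>.\<close>

lemma short_window_bound:
  assumes abc: "explicit_abc" and k: "2 \<le> k" "real k \<le> real n powr (1 / 8)" "2 * k \<le> n"
    and L: "ln (real n) \<ge> 16" "ln (ln (real n) / 448) > 448 * K + 1" and K: "K \<ge> 0"
    and small: "\<And>m p. n - k < m \<Longrightarrow> m \<le> n \<Longrightarrow> prime p \<Longrightarrow> p dvd m \<Longrightarrow> p \<le> A"
  shows "ln (fact A) > K * real k * ln (real n)"
proof -
  define l where "l = ln (real n)"
  have n: "real n > 0" using k by simp
  have lnk: "ln (real k) \<le> l / 8"
  proof -
    have "ln (real k) \<le> ln (real n powr (1 / 8))" using k n by (subst ln_le_cancel_iff) auto
    then show ?thesis using n by (simp add: l_def ln_powr)
  qed
  have "ln (real n / 2) = l - ln 2" using n by (simp add: l_def ln_div)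
  then have ln2: "ln (real n / 2) \<ge> l - 1" using ln_le_minus_one[of "2::real"] by simp
  have "real k * (2 / 7) * (l - 1) \<le> real k * (2 / 7) * ln (real n / 2)"
    using ln2 by (intro mult_left_mono) auto
  also have "\<dots> \<le> 2 * (psi A + ln (fact k))"
    by (rule explicit_abc_window[OF abc k(1,3) small])
  also have "\<dots> \<le> 2 * (4 * real A + real k * (l / 8))"
  proof -
    have "ln (fact k) \<le> real k * ln (real k)" using k by (intro ln_fact_le) auto
    also have "\<dots> \<le> real k * (l / 8)" using lnk by (intro mult_left_mono) auto
    finally show ?thesis using psi_le[of A] by (intro mult_left_mono add_mono) auto
  qed
  finally have "real k * (l / 28 - 2 / 7) \<le> 8 * real A"
    by (simp add: algebra_simps)
  moreover have "real k * (l / 56) \<le> real k * (l / 28 - 2 / 7)"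
    using L(1) by (intro mult_left_mono) (auto simp: l_def)
  ultimately have A: "real k * l / 448 \<le> real A" by simp
  define x where "x = real k * l / 448"
  have l: "l \<ge> 16" using L by (simp add: l_def)
  have kl: "real k * l \<ge> 1 * l" using k l by (intro mult_right_mono) auto
  have x: "x > 0" using k l by (simp add: x_def)
  have "ln (l / 448) \<le> ln x" using kl l x by (simp add: x_def)
  then have lx: "ln x > 448 * K + 1" using L(2) by (simp add: l_def)
  have "K * real k * l = x * (448 * K)" by (simp add: x_def)
  also have "\<dots> < x * (ln x - 1)" using x lx by (intro mult_strict_left_mono) auto
  also have "\<dots> \<le> ln (fact A)"
    using x lx A K by (intro ln_fact_ge_of_le) (auto simp: x_def)
  finally show ?thesis by (simp add: l_def)
qed

text \<open>Comparing \<open>(n / k) ^ k\<close> with the weight of the prime powers in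
  \<open>n choose k\<close> gives \<open>A \<ge> (16 * K + 1) * k\<close>; since \<open>ln k\<close>
  is at least an eighth of \<open>ln n\<close>, Stirling's bound for \<open>A!\<close> then
  suffices.\<close>

lemma medium_window_bound:
  assumes k: "0 < k" "real n powr (1 / 8) \<le> real k" "k \<le> n"
    and M: "ln (real n / real k) \<ge> 60 * (16 * K + 1) + 1" and K: "K \<ge> 0"
    and n: "4 * log 2 (real n) * real n powr (1 / 16) \<le> real n powr (1 / 8)" "ln (real n) \<ge> 16"
    and small: "\<And>m p. n - k < m \<Longrightarrow> m \<le> n \<Longrightarrow> prime p \<Longrightarrow> p dvd m \<Longrightarrow> p \<le> A"
  shows "ln (fact A) > K * real k * ln (real n)"
proof -
  define l where "l = ln (real n)"
  \<comment> \<open>Bounds the bases of powers with exponent at least 16. Their total weight is at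
    most \<open>n powr (1 / 8)\<close>, hence at most \<open>k\<close>; exponents up to 15 account
    for the constant \<open>60 = 15 * 4\<close>.\<close>
  define z where "z = nat \<lfloor>real n powr (1 / 16)\<rfloor>"
  have n0: "real n > 0" "n > 0" using k by auto
  have z: "real z \<le> real n powr (1 / 16)" by (simp add: z_def)
  have pz: "p \<le> z" if "p ^ Suc 15 \<le> n" for p
  proof -
    have "real (p ^ Suc 15) \<le> real n" using that by (intro of_nat_mono)
    then have "(real p ^ 16) powr (1 / 16) \<le> real n powr (1 / 16)" by (intro powr_mono2) auto
    moreover have "(real p ^ 16) powr (1 / 16) = real p"
    proof (cases "p = 0")
      case False
      then show ?thesis using powr_powr[of "real p" 16 "1 / 16"] by (simp add: powr_numeral)
    qed auto
    ultimately show ?thesis by (simp add: z_def le_nat_floor)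
  qed
  obtain B where B: "2 ^ B \<le> n" "n < 2 ^ Suc B"
    using ex_power_ivl1[of 2 n] n0 by auto
  have "real k * ln (real n / real k) = ln ((real n / real k) ^ k)"
    using k n0 by (simp add: ln_realpow)
  also have "\<dots> \<le> ln (real (n choose k))"
    using k n0 binomial_ge_n_over_k_pow_k[of k n, where ?'a=real] by simp
  also have "\<dots> \<le> psi_smooth A n"
    by (rule ln_binomial_le_psi_smooth[OF k(3) small])
  also have "\<dots> \<le> real 15 * psi A + real B * psi z"
    by (rule psi_smooth_le[OF pz B(2)])
  also have "\<dots> \<le> real 15 * (4 * real A) + log 2 (real n) * (4 * real n powr (1 / 16))"
    using le_log2_of_power[OF B(1)] psi_le[of A] psi_le[of z] z psi_nonneg[of z] psi_nonneg[of A] n0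
    by (intro add_mono mult_mono) auto
  also have "\<dots> \<le> 60 * real A + real k" using n(1) k(2) by simp
  finally have "real k * ln (real n / real k) \<le> 60 * real A + real k" .
  moreover have "real k * (60 * (16 * K + 1) + 1) \<le> real k * ln (real n / real k)"
    using M by (intro mult_left_mono) auto
  ultimately have "real k * (60 * (16 * K + 1) + 1) \<le> 60 * real A + real k" by linarith
  then have A: "real k * (16 * K + 1) \<le> real A" by (simp add: algebra_simps)
  define x where "x = real k * (16 * K + 1)"
  have xk: "x \<ge> real k * 1" unfolding x_def using K by (intro mult_left_mono) auto
  have x: "x > 0" using xk k by linarith
  have "l / 8 = ln (real n powr (1 / 8))" using n0 by (simp add: l_def ln_powr)
  also have "\<dots> \<le> ln (real k)" using k n0 by (subst ln_le_cancel_iff) auto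
  also have "\<dots> \<le> ln x" using xk k x by simp
  finally have lx: "l / 8 \<le> ln x" .
  have l: "l \<ge> 16" using n by (simp add: l_def)
  have "K * real k * l < x * (l / 16)"
  proof -
    have "real k * l > 0" using k l by simp
    moreover have "x * (l / 16) = K * real k * l + real k * l / 16" by (simp add: x_def algebra_simps)
    ultimately show ?thesis by linarith
  qed
  also have "\<dots> \<le> x * (ln x - 1)" using x lx l by (intro mult_left_mono) auto
  also have "\<dots> \<le> ln (fact A)" using x lx A l by (intro ln_fact_ge_of_le) (auto simp: x_def)
  finally show ?thesis by (simp add: l_def)
qed

lemma smooth_window_bound:
  assumes abc: "explicit_abc" and K: "K \<ge> 0"
  shows "\<forall>\<^sub>F n in sequentially. \<forall>k A. 2 \<le> k \<longrightarrow> k \<le> n \<longrightarrow> A \<le> n - k \<longrightarrow>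
    (\<forall>m p. n - k < m \<longrightarrow> m \<le> n \<longrightarrow> prime p \<longrightarrow> p dvd m \<longrightarrow> p \<le> A) \<longrightarrow>
    ln (fact A) > K * real k * ln (real n)"
proof -
  \<comment> \<open>Chosen so that \<open>k \<le> \<delta> * n\<close> is exactly the condition on
    \<open>n / k\<close> in \<open>medium_window_bound\<close>.\<close>
  define \<delta> where "\<delta> = exp (- (60 * (16 * K + 1) + 1))"
  have \<delta>: "0 < \<delta>" "\<delta> < 1" using K by (auto simp: \<delta>_def)
  have "\<forall>\<^sub>F n in sequentially. \<exists>p. prime p \<and> (1 - \<delta>) * real n < real p \<and> p \<le> n"
    by (rule eventually_prime_in_short_interval[OF \<delta>])
  moreover have "\<forall>\<^sub>F n::nat in sequentially. ln (real n) \<ge> 16" by real_asymp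
  moreover have "filterlim (\<lambda>n::nat. ln (ln (real n) / 448)) at_top sequentially" by real_asymp
  then have "\<forall>\<^sub>F n::nat in sequentially. ln (ln (real n) / 448) > 448 * K + 1"
    unfolding filterlim_at_top_dense by blast
  moreover have "\<forall>\<^sub>F n::nat in sequentially. 2 * real n powr (1 / 8) \<le> real n" by real_asymp
  moreover have "\<forall>\<^sub>F n::nat in sequentially. 4 * log 2 (real n) * real n powr (1 / 16) \<le> real n powr (1 / 8)"
    by real_asymp
  ultimately show ?thesis
    using eventually_gt_at_top[of 0]
  proof eventually_elim
    case (elim n)
    show ?case
    proof (intro allI impI)
      fix k A :: nat
      assume k: "2 \<le> k" "k \<le> n" and A: "A \<le> n - k"
        and s: "\<forall>m p. n - k < m \<longrightarrow> m \<le> n \<longrightarrow> prime p \<longrightarrow> p dvd m \<longrightarrow> p \<le> A"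
      then have small: "\<And>m p. n - k < m \<Longrightarrow> m \<le> n \<Longrightarrow> prime p \<Longrightarrow> p dvd m \<Longrightarrow> p \<le> A" by blast
      consider "real k \<le> real n powr (1 / 8)" | "real n powr (1 / 8) \<le> real k" "real k \<le> \<delta> * real n" | "real k > \<delta> * real n"
        by linarith
      then show "ln (fact A) > K * real k * ln (real n)"
      proof cases
        case 1
        then have "real (2 * k) \<le> real n" using elim by simp
        then have "2 * k \<le> n" by (simp only: of_nat_le_iff)
        then show ?thesis using elim K k by (intro short_window_bound[OF abc k(1) 1 _ _ _ K small]) auto
      next
        case 2
        have "ln (real k) \<le> ln (\<delta> * real n)" using 2 k \<delta> elim by simp
        also have "\<dots> = ln \<delta> + ln (real n)" using \<delta> elim by (simp add: ln_mult)
        finally have "ln (real n / real k) \<ge> 60 * (16 * K + 1) + 1" using k elim by (simp add: \<delta>_def ln_div)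
        then show ?thesis using elim k by (intro medium_window_bound[OF _ 2(1) k(2) _ K _ _ small]) auto
      next
        case 3
        \<comment> \<open>The window contains \<open>{(1 - \<delta>) * n<..n}\<close> and thus this
          prime, so smoothness would give \<open>p \<le> A \<le> n - k < p\<close>.\<close>
        obtain p where p: "prime p" "(1 - \<delta>) * real n < real p" "p \<le> n" using elim by blast
        have "real (n - k) < real p" using p(2) 3 k by (simp add: of_nat_diff algebra_simps)
        then have "n - k < p" by simp
        then have "p \<le> A" using small[of p p] p by simp
        then show ?thesis using A \<open>n - k < p\<close> by simp
      qed
    qed
  qed
qed

section \<open>From solutions to smooth windows\<close>

lemma fact_split_interval:
  fixes a n :: nat
  assumes "a \<le> n"
  shows "fact n = fact a * \<Prod>{a<..n}"
  using fact_eq_fact_times[OF assms] by (simp add: atLeastSucAtMost_greaterThanAtMost)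

lemma prod_interval_le_power:
  assumes "n \<le> (N::nat)"
  shows "\<Prod>{a<..n} \<le> N ^ (n - a)"
proof -
  have "\<Prod>{a<..n} \<le> (\<Prod>_\<in>{a<..n}. N)" using assms by (intro prod_mono) auto
  then show ?thesis by simp
qed

lemma nth_le_nth_0:
  fixes xs :: "nat list"
  assumes "\<forall>l. 1 \<le> l \<and> l < length xs \<longrightarrow> xs ! l \<le> xs ! (l - 1)" "l < length xs"
  shows "xs ! l \<le> xs ! 0"
  using assms(2)
proof (induction l)
  case (Suc l)
  then show ?case using assms(1)[rule_format, of "Suc l"] by simp
qed simp

text \<open>\<open>A\<close> is the largest unmatched entry. After cancellation the window product
  divides the product of the unmatched factorials, which bounds its primes by \<open>A\<close>; and
  \<open>A!\<close> is at most a product of interval products whose total length is at most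
  \<open>(1 + (s - 1) * c) * k\<close>.\<close>

lemma Nset_window:
  assumes st: "2 < s" "s < t" and v: "valid_indices s t i" and N: "(as, ns) \<in> Nset s t c i"
  defines "n \<equiv> ns ! 0" and "k \<equiv> ns ! 0 - as ! 0"
  obtains A where "2 \<le> k" "k \<le> n" "A \<le> n - k"
    "\<And>m p. n - k < m \<Longrightarrow> m \<le> n \<Longrightarrow> prime p \<Longrightarrow> p dvd m \<Longrightarrow> p \<le> A"
    "fact A \<le> n ^ ((1 + (s - 1) * c) * k)"
proof -
  have len: "length as = t" "length ns = s"
    and mono: "\<forall>l. 1 \<le> l \<and> l < t \<longrightarrow> as ! l \<le> as ! (l - 1)" "\<forall>j. 1 \<le> j \<and> j < s \<longrightarrow> ns ! j \<le> ns ! (j - 1)"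
    and eq: "prod_list (map (\<lambda>x. fact x :: nat) as) = prod_list (map (\<lambda>y. fact y :: nat) ns)"
    and nontriv: "\<forall>x\<in>set as. \<forall>y\<in>set ns. \<bar>int x - int y\<bar> \<noteq> 1"
    and lt0: "as ! 0 < ns ! 0" and ltj: "\<forall>j\<in>{2..s}. as ! (i j - 1) < ns ! (j - 1)"
    and ratio: "real (Max ((\<lambda>j. ns ! (j - 1) - as ! (i j - 1)) ` {2..s})) / real (ns ! 0 - as ! 0) \<le> real c"
    using N unfolding Nset_def is_nontrivial_solution_def is_solution_def by auto
  have asle: "as ! l \<le> as ! 0" if "l < t" for l
    using nth_le_nth_0[of as l] mono(1) len that by simp
  have nsle: "ns ! j \<le> n" if "j < s" for j
    using nth_le_nth_0[of ns j] mono(2) len that by (simp add: n_def)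
  have in0: "as ! 0 \<in> set as" "ns ! 0 \<in> set ns" using len st by auto
  have nk: "n - k = as ! 0" using lt0 by (simp add: n_def k_def)
  have "\<bar>int (as ! 0) - int (ns ! 0)\<bar> \<noteq> 1" using nontriv in0 by blast
  then have k2: "2 \<le> k" using lt0 unfolding k_def by linarith
  \<comment> \<open>The matching in list positions, which start at 0 while \<open>i\<close> counts
    from 1; the two first entries are matched with each other.\<close>
  define \<sigma> where "\<sigma> = (\<lambda>j. if j = 0 then 0 else i (Suc j) - 1)"
  have irange: "i j \<in> {2..t}" if "j \<in> {2..s}" for j using v that by (simp add: valid_indices_def)
  have iinj: "i j = i j' \<Longrightarrow> j = j'" if "j \<in> {2..s}" "j' \<in> {2..s}" for j j'
    using v that by (auto simp: valid_indices_def dest: inj_onD)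
  have \<sigma>lt: "\<sigma> j < t" if "j < s" for j
    using irange[of "Suc j"] that st by (auto simp: \<sigma>_def)
  have \<sigma>pos: "\<sigma> j \<noteq> 0" if "j < s" "j \<noteq> 0" for j
    using irange[of "Suc j"] that by (auto simp: \<sigma>_def)
  have \<sigma>inj: "inj_on \<sigma> {..<s}"
  proof (rule inj_onI)
    fix j j' assume j: "j \<in> {..<s}" "j' \<in> {..<s}" and e: "\<sigma> j = \<sigma> j'"
    show "j = j'"
    proof (cases "j = 0 \<or> j' = 0")
      case True
      moreover have "\<sigma> 0 = 0" by (simp add: \<sigma>_def)
      ultimately show ?thesis using \<sigma>pos[of j] \<sigma>pos[of j'] j e by (metis lessThan_iff)
    next
      case False
      then have "i (Suc j) = i (Suc j')"
        using e irange[of "Suc j"] irange[of "Suc j'"] j by (auto simp: \<sigma>_def)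
      then show ?thesis using iinj[of "Suc j" "Suc j'"] j False by auto
    qed
  qed
  have \<sigma>less: "as ! \<sigma> j < ns ! j" if "j < s" for j
  proof (cases "j = 0")
    case False
    then show ?thesis using ltj[rule_format, of "Suc j"] that by (simp add: \<sigma>_def)
  qed (simp add: \<sigma>_def lt0)
  \<comment> \<open>Positions of the unmatched entries; \<open>s < t\<close> makes this set
    non-empty.\<close>
  define R where "R = {..<t} - \<sigma> ` {..<s}"
  have finR: "finite R" by (simp add: R_def)
  have "card R = t - s"
    unfolding R_def using \<sigma>inj \<sigma>lt by (subst card_Diff_subset) (auto simp: card_image)
  then have Rne: "R \<noteq> {}" using st by auto
  have "(\<Prod>l<t. fact (as ! l)) = (\<Prod>j<s. fact (ns ! j) :: nat)"
    using eq by (simp add: prod.list_conv_set_nth len atLeast0LessThan)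
  moreover have "(\<Prod>l<t. fact (as ! l) :: nat) = (\<Prod>l\<in>R. fact (as ! l)) * (\<Prod>l\<in>\<sigma> ` {..<s}. fact (as ! l))"
    unfolding R_def using \<sigma>lt by (intro prod.subset_diff) auto
  moreover have "(\<Prod>l\<in>\<sigma> ` {..<s}. fact (as ! l) :: nat) = (\<Prod>j<s. fact (as ! \<sigma> j))"
    using \<sigma>inj by (simp add: prod.reindex)
  moreover have "(\<Prod>j<s. fact (ns ! j) :: nat) = (\<Prod>j<s. fact (as ! \<sigma> j)) * (\<Prod>j<s. \<Prod>{as ! \<sigma> j<..ns ! j})"
    unfolding prod.distrib[symmetric] using \<sigma>less by (intro prod.cong refl fact_split_interval) (auto intro: less_imp_le)
  moreover have "(\<Prod>j<s. fact (as ! \<sigma> j) :: nat) > 0" by (intro prod_pos) auto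
  \<comment> \<open>The equation after each matched factorial is cancelled against the one above
    it.\<close>
  ultimately have main: "(\<Prod>l\<in>R. fact (as ! l) :: nat) = (\<Prod>j<s. \<Prod>{as ! \<sigma> j<..ns ! j})"
    by (simp add: mult.commute)
  define A where "A = Max ((\<lambda>l. as ! l) ` R)"
  have Age: "as ! l \<le> A" if "l \<in> R" for l unfolding A_def using that finR by (intro Max_ge) auto
  have "A \<in> (\<lambda>l. as ! l) ` R" unfolding A_def using finR Rne by (intro Max_in) auto
  then obtain l0 where l0: "l0 \<in> R" "A = as ! l0" by auto
  show ?thesis
  proof (rule that[of A])
    show "2 \<le> k" by (rule k2)
    show "k \<le> n" by (simp add: n_def k_def)
    show "A \<le> n - k" unfolding nk l0(2) using l0(1) by (intro asle) (auto simp: R_def)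
  next
    fix m p assume m: "n - k < m" "m \<le> n" and p: "prime p" "p dvd m"
    \<comment> \<open>The window is the interval for \<open>j = 0\<close>, one factor of the
      right-hand side of \<open>main\<close>.\<close>
    have "m \<in> {as ! \<sigma> 0<..ns ! 0}" using m nk by (simp add: \<sigma>_def n_def)
    then have "m dvd \<Prod>{as ! \<sigma> 0<..ns ! 0}" by (intro dvd_prodI[where f="\<lambda>x. x", simplified]) auto
    also have "\<Prod>{as ! \<sigma> 0<..ns ! 0} dvd (\<Prod>j<s. \<Prod>{as ! \<sigma> j<..ns ! j})"
      using st by (intro dvd_prodI) auto
    finally have "p dvd (\<Prod>l\<in>R. fact (as ! l) :: nat)" using p(2) main dvd_trans by metis
    then obtain l where l: "l \<in> R" "p dvd fact (as ! l)"
      using p(1) finR by (auto simp: prime_dvd_prod_iff)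
    then have "p \<le> as ! l" using p(1) by (simp add: prime_dvd_fact_iff)
    then show "p \<le> A" using Age[OF l(1)] by simp
  next
    have n1: "n \<ge> 1" using lt0 by (simp add: n_def)
    have "fact A \<le> (\<Prod>l\<in>R. fact (as ! l) :: nat)"
      unfolding l0(2) using l0(1) finR by (intro dvd_imp_le dvd_prodI) (auto intro!: prod_pos)
    also have "\<dots> = (\<Prod>j<s. \<Prod>{as ! \<sigma> j<..ns ! j})" by (rule main)
    also have "\<dots> \<le> (\<Prod>j<s. n ^ (ns ! j - as ! \<sigma> j))"
      using nsle by (intro prod_mono) (auto intro: prod_interval_le_power)
    also have "\<dots> = n ^ (\<Sum>j<s. ns ! j - as ! \<sigma> j)" by (simp add: power_sum)
    also have "\<dots> \<le> n ^ ((1 + (s - 1) * c) * k)"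
    proof (rule power_increasing[OF _ n1])
      \<comment> \<open>Here the ratio condition enters: every other interval has length at most the
        maximum, hence at most \<open>c * k\<close>.\<close>
      have kj: "ns ! j - as ! \<sigma> j \<le> c * k" if "j \<in> {1..<s}" for j
      proof -
        let ?M = "Max ((\<lambda>j. ns ! (j - 1) - as ! (i j - 1)) ` {2..s})"
        have "ns ! j - as ! \<sigma> j = (\<lambda>j. ns ! (j - 1) - as ! (i j - 1)) (Suc j)"
          using that by (simp add: \<sigma>_def)
        also have "\<dots> \<le> ?M" using that by (intro Max_ge finite_imageI imageI) auto
        finally have "real (ns ! j - as ! \<sigma> j) \<le> real ?M" by (rule of_nat_mono)
        also have "\<dots> \<le> real c * real k"
          using ratio k2 unfolding k_def by (simp add: pos_divide_le_eq)
        finally have "real (ns ! j - as ! \<sigma> j) \<le> real (c * k)" by simp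
        then show ?thesis by (simp only: of_nat_le_iff)
      qed
      have "(\<Sum>j<s. ns ! j - as ! \<sigma> j) = (ns ! 0 - as ! \<sigma> 0) + (\<Sum>j\<in>{1..<s}. ns ! j - as ! \<sigma> j)"
        using st by (simp add: atLeast0LessThan[symmetric] sum.atLeast_Suc_lessThan)
      also have "\<dots> \<le> k + (\<Sum>j\<in>{1..<s}. c * k)"
        using kj by (intro add_mono sum_mono) (auto simp: k_def \<sigma>_def)
      also have "\<dots> = (1 + (s - 1) * c) * k" by (simp add: algebra_simps)
      finally show "(\<Sum>j<s. ns ! j - as ! \<sigma> j) \<le> (1 + (s - 1) * c) * k" .
    qed
    finally show "fact A \<le> n ^ ((1 + (s - 1) * c) * k)" .
  qed
qed

theorem theorem1p2:
  fixes s t c :: nat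
  assumes "explicit_abc"
    and "2 < s" and "s < t" and "0 < c"
  shows "(\<forall>i. valid_indices s t i \<longrightarrow> finite (Nset s t c i)) \<and>
         finite (\<Union>i\<in>{i. valid_indices s t i}. Nset s t c i)"
proof -
  define K where "K = 1 + (s - 1) * c"
  obtain N where N: "\<forall>n\<ge>N. \<forall>k A. 2 \<le> k \<longrightarrow> k \<le> n \<longrightarrow> A \<le> n - k \<longrightarrow>
    (\<forall>m p. n - k < m \<longrightarrow> m \<le> n \<longrightarrow> prime p \<longrightarrow> p dvd m \<longrightarrow> p \<le> A) \<longrightarrow>
    ln (fact A) > real K * real k * ln (real n)"
    using smooth_window_bound[OF assms(1) of_nat_0_le_iff[of K]] unfolding eventually_sequentially by (rule exE)
  \<comment> \<open>Once \<open>n < N\<close>, every entry is bounded by \<open>N\<close>, since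
    both lists are non-increasing and the first entry of \<open>as\<close> is below that of
    \<open>ns\<close>.\<close>
  define F where "F = (\<lambda>r. {xs :: nat list. set xs \<subseteq> {..N} \<and> length xs = r})"
  have fin: "finite (F t \<times> F s)" unfolding F_def by (intro finite_cartesian_product finite_lists_length_eq) auto
  have sub: "Nset s t c i \<subseteq> F t \<times> F s" if v: "valid_indices s t i" for i
  proof
    fix x assume x: "x \<in> Nset s t c i"
    obtain as ns where xe: "x = (as, ns)" by (cases x)
    define n where "n = ns ! 0"
    define k where "k = ns ! 0 - as ! 0"
    obtain A where A: "2 \<le> k" "k \<le> n" "A \<le> n - k"
      "\<And>m p. n - k < m \<Longrightarrow> m \<le> n \<Longrightarrow> prime p \<Longrightarrow> p dvd m \<Longrightarrow> p \<le> A"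
      "fact A \<le> n ^ (K * k)"
      using Nset_window[OF assms(2,3) v x[unfolded xe]] unfolding n_def k_def K_def by blast
    have "n < N"
    proof (rule ccontr)
      assume "\<not> n < N"
      then have gt: "ln (fact A) > real K * real k * ln (real n)"
        using A by (intro N[rule_format]) auto
      have "real (fact A) \<le> real (n ^ (K * k))" using A(5) by (rule of_nat_mono)
      then have "ln (fact A) \<le> ln (real n ^ (K * k))" using A by simp
      also have "\<dots> = real K * real k * ln (real n)" using A by (simp add: ln_realpow)
      finally show False using gt by simp
    qed
    have len: "length as = t" "length ns = s"
      and mono: "\<forall>l. 1 \<le> l \<and> l < t \<longrightarrow> as ! l \<le> as ! (l - 1)" "\<forall>j. 1 \<le> j \<and> j < s \<longrightarrow> ns ! j \<le> ns ! (j - 1)"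
      and lt0: "as ! 0 < ns ! 0"
      using x unfolding xe Nset_def is_nontrivial_solution_def is_solution_def by auto
    have "as ! l \<le> N" if "l < t" for l
      using nth_le_nth_0[of as l] mono(1) len that lt0 \<open>n < N\<close> by (simp add: n_def)
    moreover have "ns ! j \<le> N" if "j < s" for j
      using nth_le_nth_0[of ns j] mono(2) len that \<open>n < N\<close> by (simp add: n_def)
    ultimately show "x \<in> F t \<times> F s"
      using len unfolding xe F_def by (auto simp: in_set_conv_nth)
  qed
  \<comment> \<open>The functions \<open>i\<close> are infinitely many, their values outside
    \<open>{2..s}\<close> being free, but all the sets lie in one finite box.\<close>
  have union: "(\<Union>i\<in>{i. valid_indices s t i}. Nset s t c i) \<subseteq> F t \<times> F s" using sub by blast
  show ?thesis by (intro conjI allI impI finite_subset[OF _ fin] sub union)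
qed

end
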